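(* Let $R$ be a commutative unital absolutely flat ring which is not semi-artinian. Let $\sigma$ be the minimal ordinal at which the Loewy series $(s_\alpha R)_\alpha$ stabilizes, i.e. the minimal ordinal with $s_\sigma R=s_{\sigma+1}R$. Let $E$ be the injective hull of the $R$-module $R/\bigcap_{P\in\delta^{\sigma}\mathrm{Spec}(R)}P$. Then $E$ is an injective superdecomposable $R$-module and, as an object of the derived category $\mathrm{D}(R)$, its support coincides with $\delta^{\sigma}\mathrm{Spec}(R)$, which is the maximal perfect subset of $\mathrm{Spec}(R)$.
   Context: A ring is absolutely flat if all its modules are flat (von Neumann regular). Loewy series: for a module $M$, the socle $sM$ is the sum of its simple submodules; $s_0M=0$, $s_{\alpha+1}M$ is the submodule with $s_{\alpha+1}M/s_\alpha M=s(M/s_\alpha M)$, and $s_\lambda M=\bigcup_{\alpha<\lambda}s_\alpha M$ for $\lambda$ a limit ordinal. A ring $R$ is semi-artinian if and only if $s_\alpha R=R$ for some ordinal $\alpha$. Cantor-Bendixson derivatives of a space $X$: $\delta X$ is $X$ minus its isolated points; $\delta^0X=X$, $\delta^{\alpha+1}X=\delta(\delta^\alpha X)$, and $\delta^\lambda X=\bigcap_{\alpha<\lambda}\delta^\alpha X$ for $\lambda$ a limit ordinal. A subset of a space is perfect if it has no isolated points in its subspace topology (it is not required to be closed); the maximal perfect subset is the largest such subset. A module is superdecomposable if it is non-zero and has no non-zero indecomposable direct summand. Support in $\mathrm{D}(R)$: the Balmer spectrum $\mathrm{Spc}(\mathrm{D}(R)^c)$ is identified with the Zariski spectrum $\mathrm{Spec}(R)$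 (a prime ideal $P$ corresponding to $\{M\in \mathrm{D}(R)^c: M_P\simeq 0\}$). For $R$ absolutely flat, the tensor triangular support (which coincides with the Balmer-Favi support) of $X\in\mathrm{D}(R)$ is $\mathrm{Supp}(X)=\{P\in\mathrm{Spec}(R): g(P)\otimes X\neq 0\}$, where the idempotent $g(P)$ is $R_P\cong R/P$. *)

theory Defs
  imports
    "HOL-Analysis.Abstract_Topology"
    "HOL-Algebra.Module"
    "HOL-Algebra.Ideal"
    "HOL-Algebra.Free_Abelian_Groups"
begin

section \<open>Ordinals and transfinite iteration\<close>

text \<open>
  The ordinals represented by well-orders on subsets of \<^typ>\<open>'u\<close>, i.e. the ordinals
  below the successor cardinal of the cardinality of \<^typ>\<open>'u\<close>.
\<close>

quotient_type 'u ordinal =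
  "'u rel" / partial: "\<lambda>r s. Well_order r \<and> Well_order s \<and> (r, s) \<in> ordIso"
proof (rule part_equivpI)
  show "\<exists>r::'u rel. Well_order r \<and> Well_order r \<and> (r, r) \<in> ordIso"
    using well_order_on by (metis ordIso_reflexive well_order_on_Well_order)
  show "symp (\<lambda>r s::'u rel. Well_order r \<and> Well_order s \<and> (r, s) \<in> ordIso)"
    by (auto intro!: sympI dest: ordIso_symmetric)
  show "transp (\<lambda>r s::'u rel. Well_order r \<and> Well_order s \<and> (r, s) \<in> ordIso)"
    by (auto intro!: transpI dest: ordIso_transitive)
qed

instantiation ordinal :: (type) linorder
begin

lift_definition less_eq_ordinal :: "'u ordinal \<Rightarrow> 'u ordinal \<Rightarrow> bool"
  is "\<lambda>r s. (r, s) \<in> ordLeq"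
  by (meson ordIso_ordLeq_trans ordIso_symmetric ordLeq_ordIso_trans)

lift_definition less_ordinal :: "'u ordinal \<Rightarrow> 'u ordinal \<Rightarrow> bool"
  is "\<lambda>r s. (r, s) \<in> ordLess"
  by (meson ordIso_ordLess_trans ordIso_symmetric ordLess_ordIso_trans)

instance
proof
  fix x y z :: "'u ordinal"
  show "(x < y) = (x \<le> y \<and> \<not> y \<le> x)"
    by transfer (meson not_ordLess_ordLeq ordLess_imp_ordLeq ordLess_or_ordLeq)
  show "x \<le> x" by transfer (simp add: ordLeq_reflexive)
  show "x \<le> y \<Longrightarrow> y \<le> z \<Longrightarrow> x \<le> z" by transfer (rule ordLeq_transitive)
  show "x \<le> y \<Longrightarrow> y \<le> x \<Longrightarrow> x = y" by transfer (simp add: ordIso_iff_ordLeq)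
  show "x \<le> y \<or> y \<le> x" by transfer (meson ordLeq_total)
qed

end

lemma ordinal_exhaust:
  obtains r where "Well_order r" "a = abs_ordinal r"
  using Quotient_rep_reflp[OF Quotient_ordinal, of a] Quotient_abs_rep[OF Quotient_ordinal, of a]
  by metis

instance ordinal :: (type) wellorder
proof
  fix P :: "'u ordinal \<Rightarrow> bool" and a
  assume step: "\<And>x. (\<And>y. y < x \<Longrightarrow> P y) \<Longrightarrow> P x"
  have "Well_order r \<Longrightarrow> P (abs_ordinal r)" for r :: "'u rel"
  proof (induction r rule: wf_induct_rule[OF wf_ordLess])
    case (1 r)
    show ?case
    proof (rule step)
      fix y assume y: "y < abs_ordinal r"
      obtain s where s: "Well_order s" "y = abs_ordinal s"
        by (rule ordinal_exhaust)
      have "(s, r) \<in> ordLess"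
        using y s 1(2) by (simp add: less_ordinal.abs_eq ordIso_reflexive)
      then show "P y" using 1(1) s by blast
    qed
  qed
  then show "P a"
    using ordinal_exhaust[of a] by blast
qed

text \<open>\<open>osucc \<alpha>\<close> is only meaningful if \<open>\<alpha>\<close> is not the greatest element; there is no greatest
  element in \<^typ>\<open>'u ordinal\<close> for infinite \<^typ>\<open>'u\<close>.\<close>

definition osucc :: "'o::wellorder \<Rightarrow> 'o" where
  "osucc \<alpha> = (LEAST \<beta>. \<alpha> < \<beta>)"

lemma osucc_inject:
  fixes \<alpha> \<beta> :: "'o::wellorder"
  assumes "\<alpha> < osucc \<alpha>" "\<beta> < osucc \<beta>" "osucc \<alpha> = osucc \<beta>"
  shows "\<alpha> = \<beta>"
proof -
  have le: "osucc \<gamma> \<le> \<delta>" if "\<gamma> < \<delta>" for \<gamma> \<delta> :: 'o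
    unfolding osucc_def using that by (rule Least_le)
  show ?thesis
    using le[of \<alpha> \<beta>] le[of \<beta> \<alpha>] assms by (cases \<alpha> \<beta> rule: linorder_cases) auto
qed

text \<open>\<open>transfinite_iter z s l\<close> starts with \<open>z\<close>, applies \<open>s\<close> at successors, and applies \<open>l\<close> to the
  set of all previous values at limits.\<close>

function transfinite_iter :: "'b \<Rightarrow> ('b \<Rightarrow> 'b) \<Rightarrow> ('b set \<Rightarrow> 'b) \<Rightarrow> 'o::wellorder \<Rightarrow> 'b" where
  "transfinite_iter z s l \<alpha> =
    (if \<forall>\<beta>. \<alpha> \<le> \<beta> then z
     else if \<exists>\<beta><\<alpha>. \<alpha> = osucc \<beta> then s (transfinite_iter z s l (SOME \<beta>. \<beta> < \<alpha> \<and> \<alpha> = osucc \<beta>))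
     else l ((\<lambda>\<beta>. transfinite_iter z s l \<beta>) ` {..<\<alpha>}))"
  by pat_completeness auto
termination
proof (relation "inv_image {(x, y). x < y} (\<lambda>(z, s, l, \<alpha>). \<alpha>)", goal_cases)
  case 1
  show ?case by (intro wf_inv_image wf)
next
  case (2 z s l \<alpha>)
  then show ?case using someI_ex[of "\<lambda>\<beta>. \<beta> < \<alpha> \<and> \<alpha> = osucc \<beta>"] by auto
qed auto

declare transfinite_iter.simps [simp del]

lemma transfinite_iter_zero:
  "(\<And>\<beta>. \<alpha> \<le> \<beta>) \<Longrightarrow> transfinite_iter z s l \<alpha> = z"
  by (simp add: transfinite_iter.simps)

lemma transfinite_iter_osucc:
  fixes \<alpha> :: "'o::wellorder"
  assumes "\<alpha> < osucc \<alpha>"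
  shows "transfinite_iter z s l (osucc \<alpha>) = s (transfinite_iter z s l \<alpha>)"
proof -
  have "(SOME \<beta>. \<beta> < osucc \<alpha> \<and> osucc \<alpha> = osucc \<beta>) = \<alpha>"
    using assms osucc_inject[of _ \<alpha>] by (intro some_equality) metis+
  moreover have "\<not> (\<forall>\<beta>. osucc \<alpha> \<le> \<beta>)" "\<exists>\<beta>. \<beta> < osucc \<alpha> \<and> osucc \<alpha> = osucc \<beta>"
    using assms not_le by blast+
  ultimately show ?thesis
    by (subst transfinite_iter.simps) (simp only: if_False if_True)
qed

lemma transfinite_iter_limit:
  fixes \<alpha> :: "'o::wellorder"
  assumes "\<gamma> < \<alpha>" "\<And>\<beta>. \<beta> < \<alpha> \<Longrightarrow> \<alpha> \<noteq> osucc \<beta>"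
  shows "transfinite_iter z s l \<alpha> = l (transfinite_iter z s l ` {..<\<alpha>})"
proof -
  have "\<not> (\<forall>\<beta>. \<alpha> \<le> \<beta>)" "\<not> (\<exists>\<beta><\<alpha>. \<alpha> = osucc \<beta>)"
    using assms not_le by blast+
  then show ?thesis
    by (subst transfinite_iter.simps) (simp only: if_False)
qed

section \<open>Modules\<close>

text \<open>The fields \<open>mult\<close> and \<open>one\<close> of a module record play no role for modules.\<close>

definition self_module :: "('a, 'r) ring_scheme \<Rightarrow> ('a, 'a) module" where
  "self_module R = \<lparr>carrier = carrier R, mult = mult R, one = one R,
     ring.zero = ring.zero R, add = add R, smult = mult R\<rparr>"

definition quot_module :: "('a, 'm, 'x) module_scheme \<Rightarrow> 'm set \<Rightarrow> ('a, 'm set) module" where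
  "quot_module M N = \<lparr>carrier = a_rcosets\<^bsub>M\<^esub> N, mult = undefined, one = undefined,
     ring.zero = N, add = set_add M, smult = (\<lambda>r X. N <+>\<^bsub>M\<^esub> smult M r ` X)\<rparr>"

definition mod_hom ::
    "('a, 'r) ring_scheme \<Rightarrow> ('a, 'm, 'x) module_scheme \<Rightarrow> ('a, 'n, 'y) module_scheme \<Rightarrow> ('m \<Rightarrow> 'n) set"
  where "mod_hom R M N =
    {f \<in> carrier M \<rightarrow> carrier N.
      (\<forall>x\<in>carrier M. \<forall>y\<in>carrier M. f (x \<oplus>\<^bsub>M\<^esub> y) = f x \<oplus>\<^bsub>N\<^esub> f y) \<and>
      (\<forall>r\<in>carrier R. \<forall>x\<in>carrier M. f (r \<odot>\<^bsub>M\<^esub> x) = r \<odot>\<^bsub>N\<^esub> f x)}"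

definition is_direct_sum ::
    "('a, 'r) ring_scheme \<Rightarrow> ('a, 'm, 'x) module_scheme \<Rightarrow> 'm set \<Rightarrow> 'm set \<Rightarrow> bool" where
  "is_direct_sum R M A B \<longleftrightarrow> submodule A R M \<and> submodule B R M \<and>
     A \<inter> B = {\<zero>\<^bsub>M\<^esub>} \<and> A <+>\<^bsub>M\<^esub> B = carrier M"

definition indecomposable :: "('a, 'r) ring_scheme \<Rightarrow> ('a, 'm, 'x) module_scheme \<Rightarrow> bool" where
  "indecomposable R M \<longleftrightarrow> carrier M \<noteq> {\<zero>\<^bsub>M\<^esub>} \<and>
     (\<forall>A B. is_direct_sum R M A B \<longrightarrow> A = {\<zero>\<^bsub>M\<^esub>} \<or> B = {\<zero>\<^bsub>M\<^esub>})"

definition superdecomposable :: "('a, 'r) ring_scheme \<Rightarrow> ('a, 'm, 'x) module_scheme \<Rightarrow> bool" where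
  "superdecomposable R M \<longleftrightarrow> carrier M \<noteq> {\<zero>\<^bsub>M\<^esub>} \<and>
     \<not> (\<exists>A B. is_direct_sum R M A B \<and> indecomposable R (M\<lparr>carrier := A\<rparr>))"

text \<open>
  HOL cannot quantify over the modules on all carrier types, so injectivity and flatness carry the
  type \<^typ>\<open>'t\<close> of the elements of the test modules as a parameter. Every ideal of \<^term>\<open>R\<close>, and
  \<^term>\<open>R\<close> itself, occurs as a test module for \<^typ>\<open>'t\<close> the element type of \<^term>\<open>R\<close>; by the ideal
  criteria for injectivity (Baer) and flatness, this instance already implies all other instances.
\<close>

definition injective_module ::
    "'t itself \<Rightarrow> ('a, 'r) ring_scheme \<Rightarrow> ('a, 'm, 'x) module_scheme \<Rightarrow> bool" where
  "injective_module _ R E \<longleftrightarrow> module R E \<and>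
    (\<forall>(A :: ('a, 't) module) (B :: ('a, 't) module) i f.
       module R A \<and> module R B \<and> i \<in> mod_hom R A B \<and> inj_on i (carrier A) \<and> f \<in> mod_hom R A E \<longrightarrow>
       (\<exists>g \<in> mod_hom R B E. \<forall>x\<in>carrier A. g (i x) = f x))"

definition injective_hull ::
    "('a, 'r) ring_scheme \<Rightarrow> ('a, 'm, 'x) module_scheme \<Rightarrow> ('a, 'e, 'y) module_scheme \<Rightarrow> bool" where
  "injective_hull R M E \<longleftrightarrow> injective_module TYPE('a) R E \<and>
    (\<exists>i \<in> mod_hom R M E. inj_on i (carrier M) \<and>
      (\<forall>N. submodule N R E \<and> N \<noteq> {\<zero>\<^bsub>E\<^esub>} \<longrightarrow> N \<inter> i ` carrier M \<noteq> {\<zero>\<^bsub>E\<^esub>}))"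

section \<open>Tensor products and absolutely flat rings\<close>

text \<open>\<open>tensor R M N\<close> is the free abelian group on \<open>M \<times> N\<close> modulo the subgroup \<open>tensor_rels R M N\<close>
  generated by the bilinearity relations.\<close>

abbreviation free_pairs ::
    "('a, 'm, 'x) module_scheme \<Rightarrow> ('a, 'n, 'y) module_scheme \<Rightarrow> ('m \<times> 'n \<Rightarrow>\<^sub>0 int) monoid" where
  "free_pairs M N \<equiv> free_Abelian_group (carrier M \<times> carrier N)"

definition tensor_rels ::
    "('a, 'r) ring_scheme \<Rightarrow> ('a, 'm, 'x) module_scheme \<Rightarrow> ('a, 'n, 'y) module_scheme
      \<Rightarrow> ('m \<times> 'n \<Rightarrow>\<^sub>0 int) set" where
  "tensor_rels R M N = generate (free_pairs M N)
    ({frag_of (x \<oplus>\<^bsub>M\<^esub> x', y) - frag_of (x, y) - frag_of (x', y) | x x' y.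
        x \<in> carrier M \<and> x' \<in> carrier M \<and> y \<in> carrier N} \<union>
     {frag_of (x, y \<oplus>\<^bsub>N\<^esub> y') - frag_of (x, y) - frag_of (x, y') | x y y'.
        x \<in> carrier M \<and> y \<in> carrier N \<and> y' \<in> carrier N} \<union>
     {frag_of (r \<odot>\<^bsub>M\<^esub> x, y) - frag_of (x, r \<odot>\<^bsub>N\<^esub> y) | r x y.
        r \<in> carrier R \<and> x \<in> carrier M \<and> y \<in> carrier N})"

definition tensor ::
    "('a, 'r) ring_scheme \<Rightarrow> ('a, 'm, 'x) module_scheme \<Rightarrow> ('a, 'n, 'y) module_scheme
      \<Rightarrow> ('a, ('m \<times> 'n \<Rightarrow>\<^sub>0 int) set) module" where
  "tensor R M N = \<lparr>carrier = rcosets\<^bsub>free_pairs M N\<^esub> tensor_rels R M N,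
     mult = undefined, one = undefined,
     ring.zero = tensor_rels R M N,
     add = set_mult (free_pairs M N),
     smult = (\<lambda>r X. tensor_rels R M N <#>\<^bsub>free_pairs M N\<^esub>
                frag_extend (\<lambda>(x, y). frag_of (r \<odot>\<^bsub>M\<^esub> x, y)) ` X)\<rparr>"

text \<open>The map \<open>id \<otimes> f : M \<otimes> N \<rightarrow> M \<otimes> N'\<close> induced by \<open>f : N \<rightarrow> N'\<close>.\<close>

definition tensor_map ::
    "('a, 'r) ring_scheme \<Rightarrow> ('a, 'm, 'x) module_scheme \<Rightarrow> ('a, 'n, 'y) module_scheme
      \<Rightarrow> ('k \<Rightarrow> 'n) \<Rightarrow> ('m \<times> 'k \<Rightarrow>\<^sub>0 int) set \<Rightarrow> ('m \<times> 'n \<Rightarrow>\<^sub>0 int) set" where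
  "tensor_map R M N' f X =
     tensor_rels R M N' <#>\<^bsub>free_pairs M N'\<^esub> frag_extend (\<lambda>(x, y). frag_of (x, f y)) ` X"

definition flat_module ::
    "'t itself \<Rightarrow> ('a, 'r) ring_scheme \<Rightarrow> ('a, 'm, 'x) module_scheme \<Rightarrow> bool" where
  "flat_module _ R M \<longleftrightarrow> module R M \<and>
    (\<forall>(A :: ('a, 't) module) (B :: ('a, 't) module) f.
       module R A \<and> module R B \<and> f \<in> mod_hom R A B \<and> inj_on f (carrier A) \<longrightarrow>
       inj_on (tensor_map R M B f) (carrier (tensor R M A)))"

text \<open>The modules with elements in \<^typ>\<open>'a set\<close> include all cyclic modules, and flatness of these
  already implies that \<^term>\<open>R\<close> is von Neumann regular, so that all modules are flat.\<close>

definition absolutely_flat :: "('a, 'r) ring_scheme \<Rightarrow> bool" where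
  "absolutely_flat R \<longleftrightarrow> (\<forall>M :: ('a, 'a set) module. module R M \<longrightarrow> flat_module TYPE('a) R M)"

section \<open>The Loewy series\<close>

definition simple_submodule ::
    "('a, 'r) ring_scheme \<Rightarrow> ('a, 'm, 'x) module_scheme \<Rightarrow> 'm set \<Rightarrow> bool" where
  "simple_submodule R M S \<longleftrightarrow> submodule S R M \<and> S \<noteq> {\<zero>\<^bsub>M\<^esub>} \<and>
     (\<forall>N. submodule N R M \<and> N \<subseteq> S \<longrightarrow> N = {\<zero>\<^bsub>M\<^esub>} \<or> N = S)"

text \<open>The sum of a family of submodules is the least submodule containing all of them.\<close>

definition socle :: "('a, 'r) ring_scheme \<Rightarrow> ('a, 'm, 'x) module_scheme \<Rightarrow> 'm set" where
  "socle R M = \<Inter>{N. submodule N R M \<and> (\<forall>S. simple_submodule R M S \<longrightarrow> S \<subseteq> N)}"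

definition loewy_step :: "('a, 'r) ring_scheme \<Rightarrow> ('a, 'm, 'x) module_scheme \<Rightarrow> 'm set \<Rightarrow> 'm set" where
  "loewy_step R M N = {x \<in> carrier M. N +>\<^bsub>M\<^esub> x \<in> socle R (quot_module M N)}"

definition loewy ::
    "('a, 'r) ring_scheme \<Rightarrow> ('a, 'm, 'x) module_scheme \<Rightarrow> 'o::wellorder \<Rightarrow> 'm set" where
  "loewy R M = transfinite_iter {\<zero>\<^bsub>M\<^esub>} (loewy_step R M) Union"

text \<open>
  A strictly increasing transfinite sequence of subsets of \<^typ>\<open>'a\<close> has length of cardinality at most
  that of \<^typ>\<open>'a\<close>. Hence the Loewy series of \<^term>\<open>R\<close> stabilizes within \<^typ>\<open>('a + nat) ordinal\<close>,
  and no larger ordinals are needed. The summand \<^typ>\<open>nat\<close> ensures that successors exist.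
\<close>

definition semi_artinian :: "('a, 'r) ring_scheme \<Rightarrow> bool" where
  "semi_artinian R \<longleftrightarrow> (\<exists>\<alpha> :: ('a + nat) ordinal. loewy R (self_module R) \<alpha> = carrier R)"

definition loewy_length :: "('a, 'r) ring_scheme \<Rightarrow> ('a + nat) ordinal" where
  "loewy_length R =
     (LEAST \<alpha>. loewy R (self_module R) \<alpha> = loewy R (self_module R) (osucc \<alpha>))"

section \<open>The Zariski spectrum and Cantor--Bendixson derivatives\<close>

definition Spec :: "('a, 'r) ring_scheme \<Rightarrow> 'a set set" where
  "Spec R = {P. primeideal P R}"

definition zariski :: "('a, 'r) ring_scheme \<Rightarrow> 'a set topology" where
  "zariski R = topology (\<lambda>U. \<exists>A \<subseteq> carrier R. U = {P \<in> Spec R. \<not> A \<subseteq> P})"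

lemma istopology_zariski:
  "istopology (\<lambda>U. \<exists>A \<subseteq> carrier R. U = {P \<in> Spec R. \<not> A \<subseteq> P})"
  unfolding istopology_def
proof (intro conjI allI impI)
  fix U V
  assume "\<exists>A \<subseteq> carrier R. U = {P \<in> Spec R. \<not> A \<subseteq> P}" "\<exists>A \<subseteq> carrier R. V = {P \<in> Spec R. \<not> A \<subseteq> P}"
  then obtain A B where A: "A \<subseteq> carrier R" "U = {P \<in> Spec R. \<not> A \<subseteq> P}"
    and B: "B \<subseteq> carrier R" "V = {P \<in> Spec R. \<not> B \<subseteq> P}" by blast
  let ?C = "{c \<in> carrier R. \<exists>a\<in>A. \<exists>b\<in>B. c = a \<otimes>\<^bsub>R\<^esub> b}"
  have "\<not> A \<subseteq> P \<and> \<not> B \<subseteq> P \<longleftrightarrow> \<not> ?C \<subseteq> P" if P: "P \<in> Spec R" for P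
  proof -
    interpret primeideal P R using P by (simp add: Spec_def)
    show ?thesis
    proof
      assume "\<not> A \<subseteq> P \<and> \<not> B \<subseteq> P"
      then obtain a b where ab: "a \<in> A" "a \<notin> P" "b \<in> B" "b \<notin> P" by blast
      then have "a \<in> carrier R" "b \<in> carrier R" using A(1) B(1) by auto
      then have "a \<otimes>\<^bsub>R\<^esub> b \<in> ?C" "a \<otimes>\<^bsub>R\<^esub> b \<notin> P"
        using ab I_prime by auto
      then show "\<not> ?C \<subseteq> P" by blast
    next
      assume "\<not> ?C \<subseteq> P"
      then obtain a b where ab: "a \<in> A" "b \<in> B" "a \<otimes>\<^bsub>R\<^esub> b \<notin> P" by auto
      then have "a \<in> carrier R" "b \<in> carrier R" using A(1) B(1) by auto
      then have "a \<notin> P" "b \<notin> P"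
        using ab(3) I_r_closed I_l_closed by auto
      then show "\<not> A \<subseteq> P \<and> \<not> B \<subseteq> P" using ab by auto
    qed
  qed
  then have "U \<inter> V = {P \<in> Spec R. \<not> ?C \<subseteq> P}"
    unfolding A(2) B(2) by auto
  moreover have "?C \<subseteq> carrier R" by auto
  ultimately show "\<exists>A \<subseteq> carrier R. U \<inter> V = {P \<in> Spec R. \<not> A \<subseteq> P}"
    by (intro exI[of _ ?C]) simp
next
  fix \<U>
  assume "\<forall>U\<in>\<U>. \<exists>A \<subseteq> carrier R. U = {P \<in> Spec R. \<not> A \<subseteq> P}"
  then obtain A where A: "\<And>U. U \<in> \<U> \<Longrightarrow> A U \<subseteq> carrier R \<and> U = {P \<in> Spec R. \<not> A U \<subseteq> P}"
    by metis
  have "P \<in> \<Union>\<U> \<longleftrightarrow> P \<in> Spec R \<and> \<not> (\<Union>U\<in>\<U>. A U) \<subseteq> P" for P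
  proof -
    have "P \<in> U \<longleftrightarrow> P \<in> Spec R \<and> \<not> A U \<subseteq> P" if "U \<in> \<U>" for U
      using A[OF that] by (metis (mono_tags, lifting) mem_Collect_eq)
    then show ?thesis by (simp add: UN_subset_iff)
  qed
  then have "\<Union>\<U> = {P \<in> Spec R. \<not> (\<Union>U\<in>\<U>. A U) \<subseteq> P}" by blast
  moreover have "(\<Union>U\<in>\<U>. A U) \<subseteq> carrier R" using A by (simp add: UN_least)
  ultimately show "\<exists>A \<subseteq> carrier R. \<Union>\<U> = {P \<in> Spec R. \<not> A \<subseteq> P}" by blast
qed

lemma openin_zariski:
  "openin (zariski R) U \<longleftrightarrow> (\<exists>A \<subseteq> carrier R. U = {P \<in> Spec R. \<not> A \<subseteq> P})"
  by (simp add: zariski_def topology_inverse'[OF istopology_zariski])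

lemma topspace_zariski: "topspace (zariski R) = Spec R"
proof -
  have "\<not> carrier R \<subseteq> P" if "P \<in> Spec R" for P
  proof -
    interpret primeideal P R using that by (simp add: Spec_def)
    show ?thesis using I_notcarr Icarr by auto
  qed
  then have "Spec R = {P \<in> Spec R. \<not> carrier R \<subseteq> P}" by auto
  then have "openin (zariski R) (Spec R)"
    unfolding openin_zariski by blast
  then show ?thesis
    by (auto simp: topspace_def openin_zariski)
qed

definition isolated_points :: "'p topology \<Rightarrow> 'p set \<Rightarrow> 'p set" where
  "isolated_points X A = {x \<in> A. openin (subtopology X A) {x}}"

definition cb_derivative :: "'p topology \<Rightarrow> 'o::wellorder \<Rightarrow> 'p set" where
  "cb_derivative X = transfinite_iter (topspace X) (\<lambda>A. A - isolated_points X A) Inter"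

definition perfect_subset :: "'p topology \<Rightarrow> 'p set \<Rightarrow> bool" where
  "perfect_subset X A \<longleftrightarrow> A \<subseteq> topspace X \<and> isolated_points X A = {}"

definition max_perfect_subset :: "'p topology \<Rightarrow> 'p set \<Rightarrow> bool" where
  "max_perfect_subset X A \<longleftrightarrow> perfect_subset X A \<and> (\<forall>B. perfect_subset X B \<longrightarrow> B \<subseteq> A)"

text \<open>The intersection of the empty set of ideals is \<^term>\<open>carrier R\<close>.\<close>

definition ideal_Inter :: "('a, 'r) ring_scheme \<Rightarrow> 'a set set \<Rightarrow> 'a set" where
  "ideal_Inter R D = {a \<in> carrier R. \<forall>P\<in>D. a \<in> P}"

section \<open>Support in the derived category\<close>

text \<open>
  Objects of \<open>D(R)\<close> are represented by cochain complexes; the zero objects of \<open>D(R)\<close> are exactly the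
  acyclic complexes.
\<close>

record ('a, 'm) cpx =
  obj :: "int \<Rightarrow> ('a, 'm) module"
  dif :: "int \<Rightarrow> 'm \<Rightarrow> 'm"

definition cochain_complex :: "('a, 'r) ring_scheme \<Rightarrow> ('a, 'm) cpx \<Rightarrow> bool" where
  "cochain_complex R X \<longleftrightarrow>
     (\<forall>n. module R (obj X n) \<and> dif X n \<in> mod_hom R (obj X n) (obj X (n + 1)) \<and>
       (\<forall>x\<in>carrier (obj X n). dif X (n + 1) (dif X n x) = \<zero>\<^bsub>obj X (n + 2)\<^esub>))"

definition acyclic_complex :: "('a, 'm) cpx \<Rightarrow> bool" where
  "acyclic_complex X \<longleftrightarrow>
     (\<forall>n. {x \<in> carrier (obj X n). dif X n x = \<zero>\<^bsub>obj X (n + 1)\<^esub>} =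
          dif X (n - 1) ` carrier (obj X (n - 1)))"

text \<open>A module as a complex concentrated in degree \<open>0\<close>.\<close>

definition stalk_complex :: "('a, 'm) module \<Rightarrow> ('a, 'm) cpx" where
  "stalk_complex M = \<lparr>obj = (\<lambda>n. if n = 0 then M else M\<lparr>carrier := {\<zero>\<^bsub>M\<^esub>}\<rparr>),
                      dif = (\<lambda>n x. \<zero>\<^bsub>M\<^esub>)\<rparr>"

definition tensor_cpx ::
    "('a, 'r) ring_scheme \<Rightarrow> ('a, 'n, 'x) module_scheme \<Rightarrow> ('a, 'm) cpx
      \<Rightarrow> ('a, ('n \<times> 'm \<Rightarrow>\<^sub>0 int) set) cpx" where
  "tensor_cpx R N X = \<lparr>obj = (\<lambda>n. tensor R N (obj X n)),
                       dif = (\<lambda>n. tensor_map R N (obj X (n + 1)) (dif X n))\<rparr>"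

text \<open>
  The support over an absolutely flat ring, with \<open>g(P) = R/P\<close>. Since \<open>R/P\<close> is a flat module,
  \<open>g(P) \<otimes> X\<close> in \<open>D(R)\<close> is represented by the degreewise tensor product.
\<close>

definition Supp :: "('a, 'r) ring_scheme \<Rightarrow> ('a, 'm) cpx \<Rightarrow> 'a set set" where
  "Supp R X = {P \<in> Spec R. \<not> acyclic_complex (tensor_cpx R (quot_module (self_module R) P) X)}"

end

theory Submission
  imports Defs "HOL-Algebra.QuotRing"
begin

text \<open>
  An absolutely flat commutative ring is von Neumann regular
  (\<open>absolutely_flat_imp_regular\<close>), and everything else rests on the idempotents that
  regularity provides: every principal ideal is generated by an idempotent. It follows that primes
  are maximal and that every ideal \<open>I\<close> is the intersection of the primes in its zero locus
  \<open>V(I)\<close>.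

  Topology and Loewy series are tied together by one observation
  (\<open>isolated_points_zero_locus\<close>): a prime \<open>P \<in> V(I)\<close> is isolated in \<open>V(I)\<close> if and only if some
  minimal ideal over \<open>I\<close> is not contained in \<open>P\<close>, that is, if and only if the next Loewy step
  over \<open>I\<close> is not contained in \<open>P\<close>. By transfinite induction, \<open>\<delta>\<^sup>\<alpha> Spec R = V(s\<^sub>\<alpha> R)\<close> for
  all \<open>\<alpha>\<close> (\<open>loewy_cb_derivative\<close>). The Loewy series is an increasing sequence of subsets of \<open>R\<close>,
  so by Hartogs' theorem it stabilizes within the ordinals considered, and \<open>\<sigma>\<close> is a stage at which
  it does. With \<open>I = s\<^sub>\<sigma> R\<close>, which is a proper ideal as \<open>R\<close> is not semi-artinian, one has
  \<open>\<delta>\<^sup>\<sigma> Spec R = V(I)\<close>, the intersection of these primes is \<open>I\<close>, the module \<open>R/I\<close> has socle zero,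
  and \<open>V(I)\<close> has no isolated points. Every perfect subset survives all derivatives, so \<open>V(I)\<close> is
  the largest one.

  Let \<open>E\<close> be the injective hull of \<open>R/I\<close>. A non-zero direct summand \<open>A\<close> of \<open>E\<close> contains, by
  essentiality, the class of an idempotent \<open>e \<notin> I\<close>. As the socle of \<open>R/I\<close> is zero, the ideal
  \<open>(I + Re)/I\<close> is not simple, so it has a non-zero proper submodule, and this contains the non-zero
  class of an idempotent \<open>g\<close> with \<open>g e = g\<close>.
  Multiplication by \<open>g\<close> splits \<open>A\<close> into two summands, and both are non-zero: the first contains
  the class of \<open>g\<close>, the second that of \<open>e - g e\<close>. So \<open>A\<close> is decomposable.

  For the support, \<open>R/P \<otimes> E \<cong> E/PE\<close>, and by regularity \<open>PE\<close> consists of the \<open>y\<close> with \<open>p y = y\<close>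
  for some \<open>p \<in> P\<close>. If \<open>I \<subseteq> P\<close>, the class of \<open>1\<close> is not of this form. Otherwise some idempotent
  \<open>e \<in> I\<close> is not in \<open>P\<close>; it annihilates \<open>R/I\<close>, hence by essentiality \<open>E\<close>, so that \<open>1 - e \<in> P\<close>
  fixes all of \<open>E\<close>.

  Injectivity is given only with respect to test modules with elements in the type of \<open>R\<close>; since
  ideals are among these, Baer's criterion extends it to test modules over any type.
\<close>

section \<open>Ordinals on subsets of a type\<close>

lemma Well_order_le: "Well_order {(a, b). a \<le> (b :: 'o :: wellorder)}"
proof -
  let ?W = "{(a, b). a \<le> (b :: 'o)}"
  have F: "Field ?W = UNIV"
    by (auto simp: Field_def)
  have "?W - Id = {(x, y). x < y}"
    by auto
  then have "wf (?W - Id)"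
    using wf[where 'a = 'o] by simp
  moreover have "refl ?W" "trans ?W" "antisym ?W" "total ?W"
    unfolding refl_on_def trans_def antisym_def total_on_def by auto
  ultimately show ?thesis
    unfolding well_order_on_def linear_order_on_def partial_order_on_def preorder_on_def F by blast
qed

lemma strict_mono_wellorder_ge:
  fixes f :: "'o :: wellorder \<Rightarrow> 'o"
  assumes "\<And>a b. a < b \<Longrightarrow> f a < f b"
  shows "a \<le> f a"
proof (induction a rule: less_induct)
  case (less a)
  show ?case
    using less[of "f a"] assms[of "f a" a] by (meson leD leI)
qed

text \<open>
  Hartogs' theorem. If all ordinals on subsets of \<open>'u\<close> were injected into \<open>'u\<close>, their own order
  could be copied to a well-order \<open>r\<close> on a subset of \<open>'u\<close>. Sending each ordinal to the type of the
  corresponding initial segment of \<open>r\<close> would map the ordinals in a strictly increasing way below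
  the ordinal of \<open>r\<close>, which no well-order allows.
\<close>

lemma no_inj_ordinal: "\<not> inj (g :: 'u ordinal \<Rightarrow> 'u)"
proof
  assume g: "inj g"
  define W where "W = {(a, b). a \<le> (b :: 'u ordinal)}"
  have W: "Well_order W" and FW: "Field W = UNIV"
    unfolding W_def by (rule Well_order_le) (auto simp: Field_def)
  define r where "r = dir_image W g"
  have r: "Well_order r"
    unfolding r_def using Well_order_dir_image[OF W] g by (simp add: FW)
  then have filter: "wo_rel.ofilter r (underS r x)" for x
    by (simp add: wo_rel_def wo_rel.underS_ofilter)
  define f where "f a = abs_ordinal (Restr r (underS r (g a)))" for a
  have rg: "(g a, g b) \<in> r \<longleftrightarrow> a \<le> b" for a b
    using g by (auto simp: r_def dir_image_def W_def inj_eq)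
  have Fr: "Field r = range g"
    unfolding r_def using dir_image_Field[of W g] FW by simp
  have wo: "Well_order (Restr r A)" for A
    by (rule Well_order_Restr[OF r])
  have "f a < f b" if "a < b" for a b
  proof -
    have "underS r (g a) \<subset> underS r (g b)"
    proof
      show "underS r (g a) \<subseteq> underS r (g b)"
      proof
        fix x assume "x \<in> underS r (g a)"
        then have x: "x \<noteq> g a" "(x, g a) \<in> r" by (auto simp: underS_def)
        then obtain c where "x = g c" using Fr by (auto simp: Field_def)
        then show "x \<in> underS r (g b)"
          using x that rg[of c a] rg[of c b] injD[OF g, of c b] by (auto simp: underS_def)
      qed
      have "g a \<in> underS r (g b)" "g a \<notin> underS r (g a)"
        using that rg[of a b] injD[OF g, of a b] by (auto simp: underS_def)
      then show "underS r (g a) \<noteq> underS r (g b)" by blast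
    qed
    then have "(Restr r (underS r (g a)), Restr r (underS r (g b))) \<in> ordLess"
      using ofilter_subset_ordLess[OF r filter filter] by blast
    then show ?thesis
      unfolding f_def
      by (subst less_ordinal.abs_eq) (auto simp: wo ordIso_reflexive)
  qed
  then have "abs_ordinal r \<le> f (abs_ordinal r)"
    by (rule strict_mono_wellorder_ge)
  moreover have "f (abs_ordinal r) < abs_ordinal r"
  proof -
    have "(Restr r (underS r (g (abs_ordinal r))), r) \<in> ordLess"
      by (rule underS_Restr_ordLess[OF r]) (simp add: Fr)
    then show ?thesis
      unfolding f_def by (subst less_ordinal.abs_eq) (auto simp: wo r ordIso_reflexive)
  qed
  ultimately show False by simp
qed

text \<open>
  An ordinal below that of \<open>r\<close> is the type of an initial segment \<open>underS r x\<close>, and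
  choosing such an \<open>x\<close> for each of them is injective.
\<close>

lemma inj_on_below_ordinal:
  fixes a :: "'u ordinal"
  obtains h :: "'u ordinal \<Rightarrow> 'u" where "inj_on h {..<a}"
proof -
  obtain r where r: "Well_order r" "a = abs_ordinal r" by (rule ordinal_exhaust)
  have "\<exists>x. b = abs_ordinal (Restr r (underS r x))" if "b < a" for b
  proof -
    obtain s where s: "Well_order s" "b = abs_ordinal s" by (rule ordinal_exhaust)
    have "(s, r) \<in> ordLess"
      using that r s by (simp add: less_ordinal.abs_eq ordIso_reflexive)
    then obtain x where "s =o Restr r (underS r x)"
      using ordLess_iff_ordIso_Restr[OF r(1) s(1)] by blast
    then have "b = abs_ordinal (Restr r (underS r x))"
      using s Quotient_rel[OF Quotient_ordinal, of s "Restr r (underS r x)"]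
        Well_order_Restr[OF r(1)] ordIso_reflexive by blast
    then show ?thesis ..
  qed
  then obtain h where h: "\<And>b. b < a \<Longrightarrow> b = abs_ordinal (Restr r (underS r (h b)))"
    by metis
  have "inj_on h {..<a}"
    by (rule inj_onI) (metis h lessThan_iff)
  then show ?thesis using that by blast
qed

text \<open>
  If there were a greatest ordinal \<open>a\<close>, the injection of the ordinals below \<open>a\<close> into
  \<open>'a + nat\<close> could be extended to \<open>a\<close> itself, because \<open>'a + nat\<close> has room for one more element.
  This would contradict Hartogs' theorem.
\<close>

lemma osucc_greater: "(a :: ('a + nat) ordinal) < osucc a"
proof -
  have "\<exists>b. a < b"
  proof (rule ccontr)
    assume "\<not> (\<exists>b. a < b)"
    then have below: "b < a" if "b \<noteq> a" for b using that by (meson linorder_neqE)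
    obtain h :: "('a + nat) ordinal \<Rightarrow> 'a + nat" where h: "inj_on h {..<a}" by (rule inj_on_below_ordinal)
    \<comment> \<open>an injection that leaves \<open>Inr 0\<close> free as the value at \<open>a\<close>\<close>
    define s :: "'a + nat \<Rightarrow> 'a + nat" where "s = map_sum id Suc"
    have s: "inj s" "s x \<noteq> Inr 0" for x
      unfolding s_def by (intro sum.inj_map) (simp, simp, cases x, simp_all)
    define g where "g b = (if b = a then Inr 0 else s (h b))" for b
    have "inj g"
    proof (rule injI)
      fix b c assume bc: "g b = g c"
      then have "h b = h c" if "b \<noteq> a" "c \<noteq> a"
        using that injD[OF s(1)] by (simp add: g_def)
      moreover have "b = a \<longleftrightarrow> c = a"
        using bc s(2) by (metis g_def)
      ultimately show "b = c"
        using inj_onD[OF h, of b c] below by (metis lessThan_iff)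
    qed
    then show False using no_inj_ordinal by blast
  qed
  then show ?thesis
    unfolding osucc_def by (rule LeastI_ex)
qed

lemma osucc_le: "a < b \<Longrightarrow> osucc a \<le> (b :: 'o :: wellorder)"
  unfolding osucc_def by (rule Least_le)

lemma less_osuccD: "b < osucc a \<Longrightarrow> b \<le> (a :: 'o :: wellorder)"
  using osucc_le[of a b] by (meson leD leI)

lemma wellorder_trichotomy:
  fixes a :: "'o :: wellorder"
  obtains (zero) "\<And>b. a \<le> b"
  | (osucc) b where "b < osucc b" "a = osucc b"
  | (limit) c where "c < a" "\<And>b. b < a \<Longrightarrow> a \<noteq> osucc b"
proof -
  assume cases: "(\<And>b. a \<le> b) \<Longrightarrow> thesis" "\<And>b. b < osucc b \<Longrightarrow> a = osucc b \<Longrightarrow> thesis"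
    "\<And>c. c < a \<Longrightarrow> (\<And>b. b < a \<Longrightarrow> a \<noteq> osucc b) \<Longrightarrow> thesis"
  show thesis
  proof (cases "\<exists>c. c < a")
    case False
    then show thesis by (intro cases(1)) (simp add: not_less)
  next
    case True
    then show thesis using cases(2,3) by blast
  qed
qed

text \<open>
  If the sequence never paused, choosing a new element at each step would inject the ordinals
  into \<open>'a\<close>.
\<close>
lemma mono_ordinal_sequence_stabilizes:
  fixes S :: "('a + nat) ordinal \<Rightarrow> 'a set"
  assumes mono: "\<And>a b. a \<le> b \<Longrightarrow> S a \<subseteq> S b"
  shows "\<exists>a. S a = S (osucc a)"
proof (rule ccontr)
  assume "\<not> ?thesis"
  then have "\<exists>x. x \<in> S (osucc a) - S a" for a
    using mono[of a "osucc a"] osucc_greater[of a] by fastforce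
  then obtain x where x: "\<And>a. x a \<in> S (osucc a)" "\<And>a. x a \<notin> S a" by (metis DiffE)
  have "x a \<noteq> x b" if "a < b" for a b
    using x(1)[of a] x(2)[of b] mono[OF osucc_le[OF that]] by auto
  then have "inj x"
    by (metis injI linorder_neqE)
  then have "inj (Inl \<circ> x :: _ \<Rightarrow> 'a + nat)"
    by (simp add: inj_compose)
  then show False using no_inj_ordinal by blast
qed

section \<open>Cyclic modules and the Loewy step\<close>

lemma (in cring) idealI_comm:
  assumes "H \<subseteq> carrier R" "\<zero> \<in> H"
    and "\<And>a b. a \<in> H \<Longrightarrow> b \<in> H \<Longrightarrow> a \<oplus> b \<in> H"
    and l: "\<And>r a. r \<in> carrier R \<Longrightarrow> a \<in> H \<Longrightarrow> r \<otimes> a \<in> H"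
  shows "ideal H R"
proof (rule idealI)
  have "\<ominus> a \<in> H" if "a \<in> H" for a
    using l[of "\<ominus> \<one>" a] subsetD[OF assms(1) that] that by (simp add: l_minus)
  then show "subgroup H (add_monoid R)"
    by (intro add.subgroupI) (use assms(1-3) in \<open>auto simp flip: a_inv_def\<close>)
  show "a \<otimes> x \<in> H" if "a \<in> H" "x \<in> carrier R" for a x
    using l[OF that(2,1)] m_comm[OF that(2) subsetD[OF assms(1) that(1)]] by simp
qed (auto intro: ring_axioms l)

lemma (in module) submoduleI_smult:
  assumes "H \<subseteq> carrier M" "\<zero>\<^bsub>M\<^esub> \<in> H"
    and "\<And>a b. a \<in> H \<Longrightarrow> b \<in> H \<Longrightarrow> a \<oplus>\<^bsub>M\<^esub> b \<in> H"
    and l: "\<And>r a. r \<in> carrier R \<Longrightarrow> a \<in> H \<Longrightarrow> r \<odot>\<^bsub>M\<^esub> a \<in> H"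
  shows "submodule H R M"
proof (rule submoduleI)
  show "\<ominus>\<^bsub>M\<^esub> a \<in> H" if "a \<in> H" for a
    using l[of "\<ominus> \<one>" a] subsetD[OF assms(1) that] that by (simp add: smult_l_minus)
qed (use assms in auto)

lemma submodule_zero_mem: "submodule H R M \<Longrightarrow> \<zero>\<^bsub>M\<^esub> \<in> H"
  using subgroup.one_closed[OF submodule.axioms(1)] by fastforce

lemma self_module_simps [simp]:
  "carrier (self_module R) = carrier R" "\<zero>\<^bsub>self_module R\<^esub> = \<zero>\<^bsub>R\<^esub>"
  "add (self_module R) = add R" "smult (self_module R) = mult R"
  by (simp_all add: self_module_def)

lemma self_module_cosets [simp]:
  "a_r_coset (self_module R) = a_r_coset R" "set_add (self_module R) = set_add R"
  "A_RCOSETS (self_module R) = A_RCOSETS R"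
  by (simp_all add: fun_eq_iff a_r_coset_defs set_add_defs A_RCOSETS_defs)

lemma abelian_group_cong:
  assumes "abelian_group G" "carrier H = carrier G" "\<zero>\<^bsub>H\<^esub> = \<zero>\<^bsub>G\<^esub>" "add H = add G"
  shows "abelian_group H"
proof -
  interpret G: abelian_group G by fact
  show ?thesis
    by (rule abelian_groupI)
      (auto simp: assms(2-4) G.a_ac intro: G.l_neg bexI[of _ "\<ominus>\<^bsub>G\<^esub> _"])
qed

lemma (in cring) self_module: "module R (self_module R)"
proof (rule moduleI)
  show "abelian_group (self_module R)"
    by (rule abelian_group_cong[OF abelian_group_axioms]) simp_all
qed (auto simp: cring_axioms l_distr r_distr m_assoc)

context ideal
begin

lemma quot_module_simps:
  shows "carrier (quot_module (self_module R) I) = (+>) I ` carrier R"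
    and "\<zero>\<^bsub>quot_module (self_module R) I\<^esub> = I"
    and "add (quot_module (self_module R) I) = set_add R"
  by (auto simp: quot_module_def A_RCOSETS_def')

lemma coset_eq_iff:
  assumes "a \<in> carrier R" "b \<in> carrier R"
  shows "I +> a = I +> b \<longleftrightarrow> a \<ominus> b \<in> I"
  using quotient_eq_iff_same_a_r_cos[OF is_ideal assms] by simp

lemma coset_eq_zero_iff:
  assumes "a \<in> carrier R"
  shows "I +> a = I \<longleftrightarrow> a \<in> I"
  using rcos_const_imp_mem[OF assms] a_rcos_zero[OF is_ideal] by blast

lemma coset_image_self: "(+>) I ` I = {I}"
proof -
  have "(+>) I ` I = (\<lambda>_. I) ` I"
    by (rule image_cong) (simp_all add: a_rcos_zero[OF is_ideal])
  then show ?thesis using additive_subgroup.zero_closed[OF is_additive_subgroup]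
    by (metis image_constant)
qed

lemma quot_smult:
  assumes "r \<in> carrier R" "a \<in> carrier R"
  shows "r \<odot>\<^bsub>quot_module (self_module R) I\<^esub> (I +> a) = I +> (r \<otimes> a)"
proof -
  have "set_add R I ((\<otimes>) r ` (I +> a)) = I +> (r \<otimes> a)"
  proof (intro equalityI subsetI)
    fix x assume "x \<in> set_add R I ((\<otimes>) r ` (I +> a))"
    then obtain i j where ij: "i \<in> I" "j \<in> I" "x = i \<oplus> r \<otimes> (j \<oplus> a)"
      by (auto simp: set_add_def' a_r_coset_def')
    then have "x = (i \<oplus> r \<otimes> j) \<oplus> r \<otimes> a"
      using assms by (simp add: r_distr a_assoc Icarr)
    then show "x \<in> I +> (r \<otimes> a)"
      using ij assms by (auto simp: a_r_coset_def' intro!: I_l_closed)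
  next
    fix x assume "x \<in> I +> (r \<otimes> a)"
    then obtain i where i: "i \<in> I" "x = i \<oplus> r \<otimes> a"
      by (auto simp: a_r_coset_def')
    moreover have "r \<otimes> a \<in> (\<otimes>) r ` (I +> a)"
      using a_rcos_self assms by blast
    ultimately show "x \<in> set_add R I ((\<otimes>) r ` (I +> a))"
      unfolding set_add_def' by blast
  qed
  then show ?thesis by (simp add: quot_module_def)
qed

lemma quot_module:
  assumes "cring R"
  shows "module R (quot_module (self_module R) I)"
proof (rule moduleI)
  show "abelian_group (quot_module (self_module R) I)"
    by (rule abelian_group_cong[OF ring.is_abelian_group[OF quotient_is_ring]])
      (simp_all add: FactRing_def quot_module_def)
qed (auto simp: assms quot_module_simps quot_smult a_rcos_sum l_distr r_distr m_assoc)

text \<open>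
  The submodules of \<open>R/I\<close> correspond to the ideals of \<open>R\<close> that contain \<open>I\<close>. Both directions are
  used to turn the socle of \<open>R/I\<close> into a statement about ideals.
\<close>

lemma submodule_imp_ideal:
  assumes "cring R" and N: "submodule N R (quot_module (self_module R) I)"
  shows "ideal {x \<in> carrier R. I +> x \<in> N} R" "I \<subseteq> {x \<in> carrier R. I +> x \<in> N}"
proof -
  interpret cring R by fact
  interpret Q: module R "quot_module (self_module R) I" by (rule quot_module) fact
  note N = Q.submoduleE[OF N] submodule_zero_mem[OF N]
  show "ideal {x \<in> carrier R. I +> x \<in> N} R"
  proof (rule idealI_comm, goal_cases)
    case 2
    show ?case using N(7) coset_eq_zero_iff[of \<zero>] by (simp add: quot_module_simps)
  next
    case (3 a b)
    then show ?case using N(5)[of "I +> a" "I +> b"]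
      by (simp add: quot_module_simps a_rcos_sum)
  next
    case (4 r a)
    then show ?case using N(4)[of r "I +> a"] by (simp add: quot_smult)
  qed auto
  show "I \<subseteq> {x \<in> carrier R. I +> x \<in> N}"
    using N(7) a_rcos_zero[OF is_ideal] Icarr by (auto simp: quot_module_simps)
qed

lemma submodule_eq_image:
  assumes "cring R" and N: "submodule N R (quot_module (self_module R) I)"
  shows "N = (+>) I ` {x \<in> carrier R. I +> x \<in> N}"
proof -
  interpret Q: module R "quot_module (self_module R) I" by (rule quot_module) fact
  show ?thesis using Q.submoduleE(1)[OF N] by (auto simp: quot_module_simps)
qed

lemma coset_mem_image_iff:
  assumes "ideal J R" "I \<subseteq> J" "x \<in> carrier R"
  shows "I +> x \<in> (+>) I ` J \<longleftrightarrow> x \<in> J"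
proof
  interpret J: ideal J R by fact
  assume "I +> x \<in> (+>) I ` J"
  then obtain y where y: "y \<in> J" "I +> x = I +> y" by blast
  then have "x \<ominus> y \<in> J" using assms coset_eq_iff[of x y] J.Icarr by auto
  then have "(x \<ominus> y) \<oplus> y \<in> J" using y(1) by (rule J.a_closed)
  then show "x \<in> J" using y(1) assms(3) J.Icarr by (simp add: minus_eq a_assoc l_neg)
qed auto

lemma ideal_imp_submodule:
  assumes "cring R" "ideal J R" "I \<subseteq> J"
  shows "submodule ((+>) I ` J) R (quot_module (self_module R) I)"
proof -
  interpret Q: module R "quot_module (self_module R) I" by (rule quot_module) fact
  interpret J: ideal J R by fact
  have "I = I +> \<zero>" using coset_eq_zero_iff[of \<zero>] by simp
  then have "I \<in> (+>) I ` J" using additive_subgroup.zero_closed[OF J.is_additive_subgroup] by blast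
  then show ?thesis
    by (intro Q.submoduleI_smult)
      (auto simp: quot_module_simps a_rcos_sum quot_smult J.Icarr J.I_l_closed)
qed

end

definition minimal_over :: "('a, 'r) ring_scheme \<Rightarrow> 'a set \<Rightarrow> 'a set \<Rightarrow> bool" where
  "minimal_over R I S \<longleftrightarrow> ideal S R \<and> I \<subset> S \<and>
     (\<forall>J. ideal J R \<and> I \<subseteq> J \<and> J \<subseteq> S \<longrightarrow> J = I \<or> J = S)"

lemma minimal_over_subset: "minimal_over R I S \<Longrightarrow> S \<subseteq> carrier R"
  unfolding minimal_over_def using ideal.Icarr by fast

context ideal
begin

lemma simple_submodule_imp_minimal_over:
  assumes "cring R" and N: "simple_submodule R (quot_module (self_module R) I) N"
  shows "minimal_over R I {x \<in> carrier R. I +> x \<in> N}"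
proof -
  interpret cring R by fact
  let ?S = "{x \<in> carrier R. I +> x \<in> N}"
  have sub: "submodule N R (quot_module (self_module R) I)" "N \<noteq> {I}"
    and min: "\<And>K. submodule K R (quot_module (self_module R) I) \<Longrightarrow> K \<subseteq> N \<Longrightarrow> K = {I} \<or> K = N"
    using N by (auto simp: simple_submodule_def quot_module_simps)
  note eq = submodule_eq_image[OF assms(1) sub(1)]
  have "?S \<noteq> I"
  proof
    assume "?S = I"
    then have "N = (+>) I ` I" using eq by metis
    then show False using sub(2) coset_image_self by simp
  qed
  moreover have "J = I \<or> J = ?S" if J: "ideal J R" "I \<subseteq> J" "J \<subseteq> ?S" for J
  proof -
    have "submodule ((+>) I ` J) R (quot_module (self_module R) I)"
      by (rule ideal_imp_submodule[OF assms(1) J(1,2)])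
    moreover have "(+>) I ` J \<subseteq> N" using J(3) by auto
    ultimately have *: "(+>) I ` J = {I} \<or> (+>) I ` J = N" by (rule min)
    have J': "x \<in> J \<longleftrightarrow> I +> x \<in> (+>) I ` J" if "x \<in> carrier R" for x
      using coset_mem_image_iff[OF J(1,2) that] by simp
    have "J \<subseteq> carrier R" using J(3) by auto
    from * show ?thesis
    proof
      assume "(+>) I ` J = {I}"
      then have "I +> x = I" if "x \<in> J" for x using that by blast
      then have "J \<subseteq> I" using \<open>J \<subseteq> carrier R\<close> coset_eq_zero_iff by (metis subsetD subsetI)
      then show ?thesis using J(2) by simp
    next
      assume "(+>) I ` J = N"
      then have "J = ?S" using \<open>J \<subseteq> carrier R\<close> J' by auto
      then show ?thesis ..
    qed
  qed
  ultimately show ?thesis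
    unfolding minimal_over_def using submodule_imp_ideal[OF assms(1) sub(1)] by blast
qed

lemma minimal_over_imp_simple_submodule:
  assumes "cring R" and S: "minimal_over R I S"
  shows "simple_submodule R (quot_module (self_module R) I) ((+>) I ` S)"
proof -
  interpret cring R by fact
  have S: "ideal S R" "I \<subset> S"
    and min: "\<And>J. ideal J R \<Longrightarrow> I \<subseteq> J \<Longrightarrow> J \<subseteq> S \<Longrightarrow> J = I \<or> J = S"
    using S by (auto simp: minimal_over_def)
  interpret S: ideal S R by fact
  obtain s where s: "s \<in> S" "s \<notin> I" using S(2) by blast
  then have "I +> s \<noteq> I" using coset_eq_zero_iff S.Icarr by blast
  then have ne: "(+>) I ` S \<noteq> {I}" using s(1) by blast
  have "N = {I} \<or> N = (+>) I ` S"
    if N: "submodule N R (quot_module (self_module R) I)" "N \<subseteq> (+>) I ` S" for N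
  proof -
    let ?J = "{x \<in> carrier R. I +> x \<in> N}"
    have "?J \<subseteq> S" using N(2) coset_mem_image_iff[OF S(1) psubset_imp_subset[OF S(2)]] by blast
    then have "?J = I \<or> ?J = S"
      using min submodule_imp_ideal[OF assms(1) N(1)] by blast
    then show ?thesis
    proof
      assume "?J = I"
      then show ?thesis
        using submodule_eq_image[OF assms(1) N(1)] coset_image_self by simp
    next
      assume "?J = S"
      then show ?thesis using submodule_eq_image[OF assms(1) N(1)] by simp
    qed
  qed
  then show ?thesis
    unfolding simple_submodule_def quot_module_simps
    using ideal_imp_submodule[OF assms(1) S(1) psubset_imp_subset[OF S(2)]] ne by metis
qed

text \<open>
  Since the socle is the least submodule that contains the simple submodules, its preimage in \<open>R\<close>
  is the least ideal that contains the minimal ideals over \<open>I\<close>. From here on, cosets are no longer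
  needed for the Loewy series.
\<close>

lemma loewy_step_eq:
  assumes "cring R"
  shows "loewy_step R (self_module R) I =
    \<Inter>{J. ideal J R \<and> I \<subseteq> J \<and> (\<forall>S. minimal_over R I S \<longrightarrow> S \<subseteq> J)}" (is "?L = \<Inter>?F")
proof (intro equalityI subsetI)
  fix x assume x: "x \<in> ?L"
  show "x \<in> \<Inter>?F"
  proof (intro InterI, clarify)
    fix J assume J: "ideal J R" "I \<subseteq> J" "\<forall>S. minimal_over R I S \<longrightarrow> S \<subseteq> J"
    have "N \<subseteq> (+>) I ` J" if N: "simple_submodule R (quot_module (self_module R) I) N" for N
    proof -
      have "{x \<in> carrier R. I +> x \<in> N} \<subseteq> J"
        using simple_submodule_imp_minimal_over[OF assms N] J(3) by blast
      then have "(+>) I ` {x \<in> carrier R. I +> x \<in> N} \<subseteq> (+>) I ` J" by (rule image_mono)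
      then show ?thesis
        using submodule_eq_image[OF assms] N unfolding simple_submodule_def by metis
    qed
    then have "I +> x \<in> (+>) I ` J"
      using x ideal_imp_submodule[OF assms J(1,2)]
      unfolding loewy_step_def socle_def self_module_cosets by blast
    then show "x \<in> J"
      using x coset_mem_image_iff[OF J(1,2)] by (simp add: loewy_step_def)
  qed
next
  fix x assume x: "x \<in> \<Inter>?F"
  have "carrier R \<in> ?F"
    using oneideal a_subset minimal_over_subset by blast
  then have xR: "x \<in> carrier R" using x by blast
  have "I +> x \<in> N"
    if N: "submodule N R (quot_module (self_module R) I)"
      "\<And>S. simple_submodule R (quot_module (self_module R) I) S \<Longrightarrow> S \<subseteq> N" for N
  proof -
    have "S \<subseteq> {x \<in> carrier R. I +> x \<in> N}" if "minimal_over R I S" for S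
      using N(2)[OF minimal_over_imp_simple_submodule[OF assms that]] minimal_over_subset[OF that]
      by blast
    then have "{x \<in> carrier R. I +> x \<in> N} \<in> ?F"
      using submodule_imp_ideal[OF assms N(1)] by blast
    then show ?thesis using x by blast
  qed
  then show "x \<in> ?L"
    using xR unfolding loewy_step_def socle_def self_module_cosets by simp
qed

end

section \<open>Ideals and primes of von Neumann regular rings\<close>

lemma (in cring) ideal_Union_chain:
  assumes "\<C> \<noteq> {}" "\<And>J. J \<in> \<C> \<Longrightarrow> ideal J R"
    and chain: "\<And>J K. J \<in> \<C> \<Longrightarrow> K \<in> \<C> \<Longrightarrow> J \<subseteq> K \<or> K \<subseteq> J"
  shows "ideal (\<Union>\<C>) R"
proof (rule idealI_comm)
  show "\<Union>\<C> \<subseteq> carrier R" using ideal.Icarr[OF assms(2)] by blast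
  show "\<zero> \<in> \<Union>\<C>"
    using assms(1) additive_subgroup.zero_closed[OF ideal.axioms(1)[OF assms(2)]] by blast
next
  fix a b assume "a \<in> \<Union>\<C>" "b \<in> \<Union>\<C>"
  then obtain J where J: "J \<in> \<C>" "a \<in> J" "b \<in> J"
    using chain by blast
  then show "a \<oplus> b \<in> \<Union>\<C>"
    using additive_subgroup.a_closed[OF ideal.axioms(1)[OF assms(2)]] by blast
next
  fix r a assume "r \<in> carrier R" "a \<in> \<Union>\<C>"
  then show "r \<otimes> a \<in> \<Union>\<C>" using ideal.I_l_closed[OF assms(2)] by blast
qed

definition (in cring) adjoin :: "'a set \<Rightarrow> 'a \<Rightarrow> 'a set" where
  "adjoin J a = {x \<oplus> r \<otimes> a | x r. x \<in> J \<and> r \<in> carrier R}"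

lemma (in cring) adjoin:
  assumes "ideal J R" "a \<in> carrier R"
  shows ideal_adjoin: "ideal (adjoin J a) R"
    and subset_adjoin: "J \<subseteq> adjoin J a"
    and mem_adjoin: "a \<in> adjoin J a"
    and adjoin_subset: "\<And>K. ideal K R \<Longrightarrow> J \<subseteq> K \<Longrightarrow> a \<in> K \<Longrightarrow> adjoin J a \<subseteq> K"
proof -
  interpret J: ideal J R by fact
  have zero: "\<zero> \<in> J" using J.additive_subgroup_axioms additive_subgroup.zero_closed by blast
  show sub: "J \<subseteq> adjoin J a"
  proof
    fix x assume x: "x \<in> J"
    then have "x = x \<oplus> \<zero> \<otimes> a" using assms(2) J.Icarr by simp
    then show "x \<in> adjoin J a" unfolding adjoin_def using x by blast
  qed
  have "a = \<zero> \<oplus> \<one> \<otimes> a" using assms(2) by simp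
  then show "a \<in> adjoin J a" unfolding adjoin_def using zero by blast
  show "ideal (adjoin J a) R"
  proof (rule idealI_comm)
    show "adjoin J a \<subseteq> carrier R" using assms(2) J.Icarr by (auto simp: adjoin_def)
    show "\<zero> \<in> adjoin J a" using sub zero by blast
  next
    fix b c assume "b \<in> adjoin J a" "c \<in> adjoin J a"
    then obtain x r y s where *: "x \<in> J" "r \<in> carrier R" "b = x \<oplus> r \<otimes> a"
      "y \<in> J" "s \<in> carrier R" "c = y \<oplus> s \<otimes> a" by (auto simp: adjoin_def)
    then have "b \<oplus> c = (x \<oplus> y) \<oplus> (r \<oplus> s) \<otimes> a"
      using assms(2) J.Icarr[of x] J.Icarr[of y] by (simp add: l_distr a_ac)
    then show "b \<oplus> c \<in> adjoin J a"
      unfolding adjoin_def using * J.a_closed by blast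
  next
    fix s b assume s: "s \<in> carrier R" and "b \<in> adjoin J a"
    then obtain x r where *: "x \<in> J" "r \<in> carrier R" "b = x \<oplus> r \<otimes> a"
      by (auto simp: adjoin_def)
    then have "s \<otimes> b = s \<otimes> x \<oplus> (s \<otimes> r) \<otimes> a"
      using assms(2) J.Icarr[of x] s by (simp add: r_distr m_assoc)
    then show "s \<otimes> b \<in> adjoin J a"
      unfolding adjoin_def using * J.I_l_closed s by blast
  qed
  fix K assume K: "ideal K R" "J \<subseteq> K" "a \<in> K"
  interpret K: ideal K R by fact
  show "adjoin J a \<subseteq> K"
    using K(2,3) K.I_l_closed K.a_closed by (auto simp: adjoin_def)
qed

definition zero_locus :: "('a, 'r) ring_scheme \<Rightarrow> 'a set \<Rightarrow> 'a set set" where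
  "zero_locus R J = {P \<in> Spec R. J \<subseteq> P}"

locale regular_cring = cring +
  assumes regular: "a \<in> carrier R \<Longrightarrow> \<exists>x\<in>carrier R. a = a \<otimes> a \<otimes> x"
begin

lemma square_mem_ideal:
  assumes "ideal J R" "a \<in> carrier R" "a \<otimes> a \<in> J"
  shows "a \<in> J"
  using regular[OF assms(2)] ideal.I_r_closed[OF assms(1,3)] by metis

lemma idempotent_generator:
  assumes "a \<in> carrier R"
  obtains e x where "e \<in> carrier R" "x \<in> carrier R" "e \<otimes> e = e" "e = a \<otimes> x" "a = e \<otimes> a"
proof -
  obtain x where x: "x \<in> carrier R" "a = a \<otimes> a \<otimes> x" using regular[OF assms] by blast
  show ?thesis
  proof (rule that)
    have "a \<otimes> x \<otimes> (a \<otimes> x) = (a \<otimes> a \<otimes> x) \<otimes> x" using x(1) assms by (simp add: m_ac)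
    then show "a \<otimes> x \<otimes> (a \<otimes> x) = a \<otimes> x" using x(2) by simp
    have "a \<otimes> a \<otimes> x = a \<otimes> x \<otimes> a" using x(1) assms by (simp add: m_ac)
    then show "a = a \<otimes> x \<otimes> a" using x(2) by simp
  qed (use x assms in auto)
qed

text \<open>
  An ideal \<open>P\<close> that is maximal among those which contain \<open>J\<close> but not \<open>e\<close> is prime: if \<open>a, b \<notin> P\<close>,
  then \<open>e \<in> P + Ra\<close> and \<open>e \<in> P + Rb\<close>, so \<open>e\<^sup>2 \<in> P + Rab\<close>. If \<open>ab\<close> were in \<open>P\<close>, so would be \<open>e\<^sup>2\<close>,
  and then \<open>e\<close> by regularity.
\<close>

lemma exists_prime_avoiding:
  assumes J: "ideal J R" and e: "e \<in> carrier R" "e \<notin> J"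
  shows "\<exists>P\<in>Spec R. J \<subseteq> P \<and> e \<notin> P"
proof -
  let ?A = "{K. ideal K R \<and> J \<subseteq> K \<and> e \<notin> K}"
  have "\<exists>P\<in>?A. \<forall>X\<in>?A. P \<subseteq> X \<longrightarrow> X = P"
  proof (rule subset_Zorn_nonempty)
    show "?A \<noteq> {}" using assms by blast
  next
    fix \<C> assume \<C>: "\<C> \<noteq> {}" "subset.chain ?A \<C>"
    then have "ideal (\<Union>\<C>) R"
      by (intro ideal_Union_chain) (auto simp: subset_chain_def)
    then show "\<Union>\<C> \<in> ?A" using \<C> by (auto simp: subset_chain_def)
  qed
  then obtain P where PA: "P \<in> ?A" and PX: "\<forall>X\<in>?A. P \<subseteq> X \<longrightarrow> X = P" ..
  from PA have P: "ideal P R" "J \<subseteq> P" "e \<notin> P" by simp_all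
  from PX have max: "X = P" if "ideal X R" "J \<subseteq> X" "e \<notin> X" "P \<subseteq> X" for X
    using that by simp
  interpret P: ideal P R by fact
  have e_adjoin: "\<exists>p\<in>P. \<exists>r\<in>carrier R. e = p \<oplus> r \<otimes> a" if a: "a \<in> carrier R" "a \<notin> P" for a
  proof -
    have "e \<in> adjoin P a"
      using max[OF ideal_adjoin[OF P(1) a(1)]] adjoin(2,3)[OF P(1) a(1)] P(2) a(2) by blast
    then show ?thesis by (auto simp: adjoin_def)
  qed
  have "primeideal P R"
  proof (rule primeidealI[OF P(1) is_cring])
    show "carrier R \<noteq> P" using e P(3) by blast
    fix a b assume ab: "a \<in> carrier R" "b \<in> carrier R" "a \<otimes> b \<in> P"
    show "a \<in> P \<or> b \<in> P"
    proof (rule ccontr)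
      assume n: "\<not> (a \<in> P \<or> b \<in> P)"
      obtain p r where p: "p \<in> P" "r \<in> carrier R" "e = p \<oplus> r \<otimes> a"
        using e_adjoin[of a] ab n by blast
      obtain q s where q: "q \<in> P" "s \<in> carrier R" "e = q \<oplus> s \<otimes> b"
        using e_adjoin[of b] ab n by blast
      have "e \<otimes> e = (p \<oplus> r \<otimes> a) \<otimes> (q \<oplus> s \<otimes> b)"
        using p(3) q(3) by metis
      also have "\<dots> = p \<otimes> (q \<oplus> s \<otimes> b) \<oplus> (r \<otimes> a) \<otimes> q \<oplus> (r \<otimes> s) \<otimes> (a \<otimes> b)"
        using p(1,2) q(1,2) ab P.Icarr[of p] P.Icarr[of q]
        by (simp add: l_distr r_distr m_ac a_ac)
      also have "\<dots> \<in> P"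
        using P.I_r_closed[OF p(1), of "q \<oplus> s \<otimes> b"] P.I_l_closed[OF q(1), of "r \<otimes> a"]
          P.I_l_closed[OF ab(3), of "r \<otimes> s"] p(2) q(2) ab P.Icarr[OF q(1)]
        by (simp add: P.a_closed)
      finally have "e \<in> P" using square_mem_ideal[OF P(1) e(1)] by blast
      then show False using P(3) by blast
    qed
  qed
  then show ?thesis using P by (auto simp: Spec_def)
qed

text \<open>
  If \<open>a \<in> Q - P\<close> and \<open>a = a\<^sup>2 x\<close>, then \<open>a (1 - a x) = 0 \<in> P\<close> puts \<open>1 - a x\<close> into \<open>P \<subseteq> Q\<close>, and
  with it \<open>1\<close>.
\<close>

lemma Spec_antichain:
  assumes "P \<in> Spec R" "Q \<in> Spec R" "P \<subseteq> Q"
  shows "P = Q"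
proof (rule ccontr)
  interpret P: primeideal P R using assms(1) by (simp add: Spec_def)
  interpret Q: primeideal Q R using assms(2) by (simp add: Spec_def)
  assume "P \<noteq> Q"
  then obtain a where a: "a \<in> Q" "a \<notin> P" using assms(3) by blast
  have aR: "a \<in> carrier R" using a Q.Icarr by blast
  obtain x where x: "x \<in> carrier R" "a = a \<otimes> a \<otimes> x" using regular[OF aR] by blast
  have "a \<otimes> (\<one> \<ominus> a \<otimes> x) = a \<ominus> a \<otimes> a \<otimes> x"
    using aR x(1) by (simp add: minus_eq r_distr r_minus m_assoc)
  also have "\<dots> = \<zero>" using x aR by (metis minus_eq r_neg)
  finally have "a \<otimes> (\<one> \<ominus> a \<otimes> x) \<in> P"
    using additive_subgroup.zero_closed[OF P.is_additive_subgroup] by simp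
  then have "\<one> \<ominus> a \<otimes> x \<in> Q"
    using P.I_prime[of a "\<one> \<ominus> a \<otimes> x"] a(2) aR x(1) assms(3) by auto
  moreover have "a \<otimes> x \<in> Q" using a(1) x(1) by (rule Q.I_r_closed)
  ultimately have "(\<one> \<ominus> a \<otimes> x) \<oplus> a \<otimes> x \<in> Q" by (rule Q.a_closed)
  then have "\<one> \<in> Q" using aR x(1) by (simp add: minus_eq a_assoc l_neg)
  then show False using Q.one_imp_carrier Q.I_notcarr by blast
qed

lemma Inter_zero_locus:
  assumes "ideal J R"
  shows "ideal_Inter R (zero_locus R J) = J"
  using exists_prime_avoiding[OF assms] ideal.Icarr[OF assms]
  by (auto simp: ideal_Inter_def zero_locus_def)

section \<open>Loewy series and Cantor--Bendixson derivatives\<close>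

text \<open>
  If \<open>P\<close> is isolated in \<open>V(I)\<close>, choose \<open>e \<notin> P\<close> that lies in all other primes of \<open>V(I)\<close>. Then
  \<open>I + Re\<close> is minimal over \<open>I\<close>: an ideal \<open>J\<close> in between that does not contain \<open>e\<close> is contained in
  a prime avoiding \<open>e\<close>, which can only be \<open>P\<close>; being contained in the other primes of \<open>V(I)\<close> as
  well, \<open>J\<close> equals \<open>I\<close>. Conversely, if \<open>S\<close> is minimal over \<open>I\<close> and not contained in \<open>P\<close>, then for
  every \<open>Q \<in> V(I)\<close> in the open set of primes not containing \<open>S\<close> one has
  \<open>S Q \<subseteq> S \<inter> Q = I \<subseteq> P\<close>, hence \<open>Q \<subseteq> P\<close> and \<open>Q = P\<close>.
\<close>

lemma isolated_points_zero_locus: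
  assumes I: "ideal I R"
  shows "isolated_points (zariski R) (zero_locus R I) =
    {P \<in> zero_locus R I. \<not> loewy_step R (self_module R) I \<subseteq> P}"
proof -
  interpret I: ideal I R by fact
  note step = I.loewy_step_eq[OF is_cring]
  have "openin (subtopology (zariski R) (zero_locus R I)) {P} \<longleftrightarrow>
      \<not> loewy_step R (self_module R) I \<subseteq> P" if P: "P \<in> Spec R" "I \<subseteq> P" for P
  proof
    interpret P: primeideal P R using P(1) by (simp add: Spec_def)
    assume "openin (subtopology (zariski R) (zero_locus R I)) {P}"
    then obtain B where B: "B \<subseteq> carrier R" "{P} = {Q \<in> Spec R. \<not> B \<subseteq> Q} \<inter> zero_locus R I"
      by (auto simp: openin_subtopology openin_zariski)
    then have BP: "\<not> B \<subseteq> P" and BQ: "\<And>Q. Q \<in> Spec R \<Longrightarrow> I \<subseteq> Q \<Longrightarrow> Q \<noteq> P \<Longrightarrow> B \<subseteq> Q"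
      by (auto simp: zero_locus_def)
    obtain e where e: "e \<in> B" "e \<notin> P" using BP by blast
    have eR: "e \<in> carrier R" using B(1) e(1) by blast
    have eQ: "e \<in> Q" if "Q \<in> Spec R" "I \<subseteq> Q" "Q \<noteq> P" for Q
      using BQ[OF that] e(1) by blast
    let ?S = "adjoin I e"
    note S = adjoin[OF I eR]
    have "J = I \<or> J = ?S" if J: "ideal J R" "I \<subseteq> J" "J \<subseteq> ?S" for J
    proof (cases "e \<in> J")
      case True
      then show ?thesis using S(4)[OF J(1,2)] J(3) by simp
    next
      case False
      then obtain Q where Q: "Q \<in> Spec R" "J \<subseteq> Q" "e \<notin> Q"
        using exists_prime_avoiding[OF J(1) eR] by blast
      then have "Q = P" using eQ[of Q] J(2) by blast
      then have JP: "J \<subseteq> P" using Q by simp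
      have "x \<in> I" if x: "x \<in> J" for x
      proof (rule ccontr)
        assume "x \<notin> I"
        then obtain Q where Q: "Q \<in> Spec R" "I \<subseteq> Q" "x \<notin> Q"
          using exists_prime_avoiding[OF I] ideal.Icarr[OF J(1) x] by blast
        then have "Q \<noteq> P" using JP x by blast
        then have "e \<in> Q" using eQ Q by blast
        then have "?S \<subseteq> Q"
          using S(4)[of Q] Q(1,2) by (simp add: Spec_def primeideal.axioms(1))
        then show False using Q(3) x J(3) by blast
      qed
      then show ?thesis using J(2) by blast
    qed
    moreover have "I \<noteq> ?S" using S(3) e(2) P(2) by blast
    ultimately have "minimal_over R I ?S"
      unfolding minimal_over_def using S(1,2) by blast
    then have "e \<in> loewy_step R (self_module R) I"
      unfolding step using S(3) by blast
    then show "\<not> loewy_step R (self_module R) I \<subseteq> P" using e(2) by blast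
  next
    interpret P: primeideal P R using P(1) by (simp add: Spec_def)
    assume "\<not> loewy_step R (self_module R) I \<subseteq> P"
    then obtain S where S: "minimal_over R I S" "\<not> S \<subseteq> P"
      unfolding step using P(2) P.is_ideal by blast
    have SI: "ideal S R" using S(1) by (simp add: minimal_over_def)
    have unique: "Q = P" if Q: "Q \<in> Spec R" "I \<subseteq> Q" "\<not> S \<subseteq> Q" for Q
    proof -
      interpret Q: primeideal Q R using Q(1) by (simp add: Spec_def)
      have "S \<inter> Q = I \<or> S \<inter> Q = S"
        using S(1) Q(2) i_intersect[OF SI Q.is_ideal] unfolding minimal_over_def by blast
      then have int: "S \<inter> Q = I" using Q(3) by blast
      obtain s where s: "s \<in> S" "s \<notin> P" using S(2) by blast
      have "q \<in> P" if q: "q \<in> Q" for q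
      proof -
        have "s \<otimes> q \<in> S \<inter> Q"
          using s(1) q ideal.I_r_closed[OF SI] Q.I_l_closed ideal.Icarr[OF SI] Q.Icarr by blast
        then have "s \<otimes> q \<in> P" using int P(2) by blast
        then show ?thesis
          using P.I_prime[of s q] s q ideal.Icarr[OF SI] Q.Icarr by blast
      qed
      then show ?thesis using Spec_antichain[OF Q(1) P(1)] by blast
    qed
    have "{P} = {Q \<in> Spec R. \<not> S \<subseteq> Q} \<inter> zero_locus R I"
    proof
      show "{P} \<subseteq> {Q \<in> Spec R. \<not> S \<subseteq> Q} \<inter> zero_locus R I"
        using P S(2) by (simp add: zero_locus_def)
      show "{Q \<in> Spec R. \<not> S \<subseteq> Q} \<inter> zero_locus R I \<subseteq> {P}"
        using unique unfolding zero_locus_def by blast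
    qed
    then show "openin (subtopology (zariski R) (zero_locus R I)) {P}"
      unfolding openin_subtopology openin_zariski
      using minimal_over_subset[OF S(1)] by blast
  qed
  then show ?thesis by (auto simp: isolated_points_def zero_locus_def)
qed

lemma ideal_loewy_step:
  assumes "ideal I R"
  shows "ideal (loewy_step R (self_module R) I) R" "I \<subseteq> loewy_step R (self_module R) I"
proof -
  interpret I: ideal I R by fact
  have "carrier R \<in> {J. ideal J R \<and> I \<subseteq> J \<and> (\<forall>S. minimal_over R I S \<longrightarrow> S \<subseteq> J)}"
    using oneideal I.a_subset minimal_over_subset by blast
  then show "ideal (loewy_step R (self_module R) I) R"
    unfolding I.loewy_step_eq[OF is_cring] by (intro i_Intersect) auto
  show "I \<subseteq> loewy_step R (self_module R) I"
    unfolding I.loewy_step_eq[OF is_cring] by blast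
qed

text \<open>
  Successors are covered by \<open>isolated_points_zero_locus\<close>; at limits, the zero locus of a union of
  ideals is the intersection of the zero loci. Monotonicity is part of the induction because the
  union at a limit is an ideal only for a chain.
\<close>

lemma loewy_cb_derivative:
  fixes \<alpha> :: "'o :: wellorder"
  shows "ideal (loewy R (self_module R) \<alpha>) R \<and>
    (\<forall>\<beta>\<le>\<alpha>. loewy R (self_module R) \<beta> \<subseteq> loewy R (self_module R) \<alpha>) \<and>
    cb_derivative (zariski R) \<alpha> = zero_locus R (loewy R (self_module R) \<alpha>)"
proof (induction \<alpha> rule: less_induct)
  case (less \<alpha>)
  let ?s = "\<lambda>\<beta> :: 'o. loewy R (self_module R) \<beta>"
  have id: "\<And>\<beta>. \<beta> < \<alpha> \<Longrightarrow> ideal (?s \<beta>) R"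
    and mono: "\<And>\<beta> \<gamma>. \<beta> < \<alpha> \<Longrightarrow> \<gamma> \<le> \<beta> \<Longrightarrow> ?s \<gamma> \<subseteq> ?s \<beta>"
    and cb: "\<And>\<beta>. \<beta> < \<alpha> \<Longrightarrow> cb_derivative (zariski R) \<beta> = zero_locus R (?s \<beta>)"
    using less by blast+
  show ?case
  proof (cases \<alpha> rule: wellorder_trichotomy)
    case zero
    then have "?s \<alpha> = {\<zero>}" "cb_derivative (zariski R) \<alpha> = Spec R"
      unfolding loewy_def cb_derivative_def
      by (simp_all add: transfinite_iter_zero topspace_zariski)
    moreover have "\<zero> \<in> P" if "P \<in> Spec R" for P
      using that additive_subgroup.zero_closed[OF ideal.axioms(1)[OF primeideal.axioms(1)]]
      by (auto simp: Spec_def)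
    ultimately show ?thesis
      using zero zeroideal by (auto simp: zero_locus_def dest: antisym)
  next
    case (osucc \<beta>)
    have s: "?s \<alpha> = loewy_step R (self_module R) (?s \<beta>)"
      and c: "cb_derivative (zariski R) \<alpha> = cb_derivative (zariski R) \<beta> -
        isolated_points (zariski R) (cb_derivative (zariski R) \<beta>)"
      unfolding loewy_def cb_derivative_def
      by (simp_all only: osucc(2) transfinite_iter_osucc[OF osucc(1)])
    have \<beta>: "\<beta> < \<alpha>" using osucc by simp
    note step = ideal_loewy_step[OF id[OF \<beta>]]
    have "?s \<gamma> \<subseteq> ?s \<alpha>" if "\<gamma> \<le> \<alpha>" for \<gamma>
    proof (cases "\<gamma> = \<alpha>")
      case False
      then have "\<gamma> \<le> \<beta>" using that osucc(2) less_osuccD by (metis order_le_less)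
      then show ?thesis using mono[OF \<beta>] step(2) s by blast
    qed simp
    moreover have "cb_derivative (zariski R) \<alpha> = zero_locus R (?s \<alpha>)"
      unfolding c s cb[OF \<beta>] isolated_points_zero_locus[OF id[OF \<beta>]]
      using step(2) by (auto simp: zero_locus_def)
    ultimately show ?thesis using step(1) s by simp
  next
    case (limit \<gamma>)
    have s: "?s \<alpha> = \<Union>(?s ` {..<\<alpha>})"
      and c: "cb_derivative (zariski R) \<alpha> = \<Inter>(cb_derivative (zariski R) ` {..<\<alpha>})"
      unfolding loewy_def cb_derivative_def by (rule transfinite_iter_limit[OF limit]; assumption)+
    have "ideal (\<Union>(?s ` {..<\<alpha>})) R"
    proof (rule ideal_Union_chain)
      fix J K assume "J \<in> ?s ` {..<\<alpha>}" "K \<in> ?s ` {..<\<alpha>}"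
      then obtain \<beta> \<gamma> where "\<beta> < \<alpha>" "\<gamma> < \<alpha>" "J = ?s \<beta>" "K = ?s \<gamma>" by auto
      then show "J \<subseteq> K \<or> K \<subseteq> J" using mono[of \<beta> \<gamma>] mono[of \<gamma> \<beta>] by (meson linear)
    qed (use limit(1) id in auto)
    moreover have "?s \<beta> \<subseteq> ?s \<alpha>" if "\<beta> \<le> \<alpha>" for \<beta>
      using that s by (cases "\<beta> = \<alpha>") auto
    moreover have "cb_derivative (zariski R) \<alpha> = zero_locus R (?s \<alpha>)"
    proof -
      have "cb_derivative (zariski R) ` {..<\<alpha>} = (\<lambda>\<beta>. zero_locus R (?s \<beta>)) ` {..<\<alpha>}"
        by (rule image_cong) (simp_all add: cb)
      then show ?thesis
        unfolding c s using limit(1) by (auto simp: zero_locus_def)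
    qed
    ultimately show ?thesis using s by simp
  qed
qed

lemmas ideal_loewy = loewy_cb_derivative[THEN conjunct1]
  and loewy_mono = loewy_cb_derivative[THEN conjunct2, THEN conjunct1, rule_format]
  and cb_derivative_eq_zero_locus = loewy_cb_derivative[THEN conjunct2, THEN conjunct2]

end

section \<open>Tensor products\<close>

lemma subgroup_free_Abelian_groupI:
  assumes "\<And>c. c \<in> T \<Longrightarrow> Poly_Mapping.keys c \<subseteq> S" "0 \<in> T"
    and diff: "\<And>a b. a \<in> T \<Longrightarrow> b \<in> T \<Longrightarrow> a - b \<in> T"
  shows "subgroup T (free_Abelian_group S)"
proof (rule group.subgroupI[OF group_free_Abelian_group])
  fix a b assume a: "a \<in> T" and b: "b \<in> T"
  show "inv\<^bsub>free_Abelian_group S\<^esub> a \<in> T"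
    using diff[OF assms(2) a] assms(1)[OF a] by simp
  have "- b \<in> T" using diff[OF assms(2) b] by simp
  then show "a \<otimes>\<^bsub>free_Abelian_group S\<^esub> b \<in> T"
    using diff[OF a, of "- b"] by simp
qed (use assms(1,2) in auto)

text \<open>
  The bilinearity relations, that is, the generating set in the definition of \<open>tensor_rels\<close>.
\<close>

definition tensor_gens ::
    "('a, 'r) ring_scheme \<Rightarrow> ('a, 'm, 'x) module_scheme \<Rightarrow> ('a, 'n, 'y) module_scheme
      \<Rightarrow> ('m \<times> 'n \<Rightarrow>\<^sub>0 int) set" where
  "tensor_gens R M N =
    {frag_of (x \<oplus>\<^bsub>M\<^esub> x', y) - frag_of (x, y) - frag_of (x', y) | x x' y.
        x \<in> carrier M \<and> x' \<in> carrier M \<and> y \<in> carrier N} \<union>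
     {frag_of (x, y \<oplus>\<^bsub>N\<^esub> y') - frag_of (x, y) - frag_of (x, y') | x y y'.
        x \<in> carrier M \<and> y \<in> carrier N \<and> y' \<in> carrier N} \<union>
     {frag_of (r \<odot>\<^bsub>M\<^esub> x, y) - frag_of (x, r \<odot>\<^bsub>N\<^esub> y) | r x y.
        r \<in> carrier R \<and> x \<in> carrier M \<and> y \<in> carrier N}"

lemma tensor_gensE:
  assumes "d \<in> tensor_gens R M N"
  obtains
    (left) x x' y where "x \<in> carrier M" "x' \<in> carrier M" "y \<in> carrier N"
      "d = frag_of (x \<oplus>\<^bsub>M\<^esub> x', y) - frag_of (x, y) - frag_of (x', y)"
  | (right) x y y' where "x \<in> carrier M" "y \<in> carrier N" "y' \<in> carrier N"
      "d = frag_of (x, y \<oplus>\<^bsub>N\<^esub> y') - frag_of (x, y) - frag_of (x, y')"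
  | (scalar) r x y where "r \<in> carrier R" "x \<in> carrier M" "y \<in> carrier N"
      "d = frag_of (r \<odot>\<^bsub>M\<^esub> x, y) - frag_of (x, r \<odot>\<^bsub>N\<^esub> y)"
  using assms unfolding tensor_gens_def
  by (elim UnE CollectE exE conjE) (rule left right scalar; assumption)+

lemma keys_diff_subset:
  "Poly_Mapping.keys (a :: 'c \<Rightarrow>\<^sub>0 int) \<subseteq> S \<Longrightarrow> Poly_Mapping.keys b \<subseteq> S \<Longrightarrow> Poly_Mapping.keys (a - b) \<subseteq> S"
  using keys_diff[of a b] by blast

locale module_pair = M: module R M + N: module R N for R (structure) and M and N
begin

abbreviation "F \<equiv> free_pairs M N"
abbreviation "rels \<equiv> tensor_rels R M N"

lemma tensor_gens_subset: "tensor_gens R M N \<subseteq> carrier F"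
  unfolding tensor_gens_def
  by (safe; simp only: carrier_free_Abelian_group_iff; intro keys_diff_subset; simp)

lemma subgroup_rels: "subgroup rels F"
  using group.generate_is_subgroup[OF group_free_Abelian_group tensor_gens_subset]
  by (simp add: tensor_rels_def tensor_gens_def)

lemma zero_mem_rels: "0 \<in> rels"
  using subgroup.one_closed[OF subgroup_rels] by simp

lemma keys_rels: "c \<in> rels \<Longrightarrow> Poly_Mapping.keys c \<subseteq> carrier M \<times> carrier N"
  using subgroup.mem_carrier[OF subgroup_rels] by simp

lemma rels_diff: "a \<in> rels \<Longrightarrow> b \<in> rels \<Longrightarrow> a - b \<in> rels"
  using subgroup.m_closed[OF subgroup_rels, of a "- b"]
    subgroup.m_inv_closed[OF subgroup_rels, of b] keys_rels[of b] by simp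

lemma rels_uminus: "a \<in> rels \<Longrightarrow> - a \<in> rels"
  using rels_diff[OF zero_mem_rels] by simp

lemma rels_add: "a \<in> rels \<Longrightarrow> b \<in> rels \<Longrightarrow> a + b \<in> rels"
  using rels_diff[OF _ rels_uminus] by simp

lemma gens_mem_rels: "c \<in> tensor_gens R M N \<Longrightarrow> c \<in> rels"
  unfolding tensor_rels_def tensor_gens_def by (rule generate.incl)

lemma rels_subset:
  assumes "\<And>c. c \<in> T \<Longrightarrow> Poly_Mapping.keys c \<subseteq> carrier M \<times> carrier N" "0 \<in> T"
    and "\<And>a b. a \<in> T \<Longrightarrow> b \<in> T \<Longrightarrow> a - b \<in> T" "tensor_gens R M N \<subseteq> T"
  shows "rels \<subseteq> T"
proof -
  have "generate F (tensor_gens R M N) \<subseteq> T"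
    using assms
    by (intro group.generate_subgroup_incl[OF group_free_Abelian_group]
        subgroup_free_Abelian_groupI) auto
  then show ?thesis by (simp add: tensor_rels_def tensor_gens_def)
qed

lemma pure_tensor_zero_left:
  assumes "y \<in> carrier N"
  shows "frag_of (\<zero>\<^bsub>M\<^esub>, y) \<in> rels"
proof -
  have "frag_of (\<zero>\<^bsub>M\<^esub> \<oplus>\<^bsub>M\<^esub> \<zero>\<^bsub>M\<^esub>, y) - frag_of (\<zero>\<^bsub>M\<^esub>, y) - frag_of (\<zero>\<^bsub>M\<^esub>, y) \<in> tensor_gens R M N"
    unfolding tensor_gens_def using assms by blast
  then have "- frag_of (\<zero>\<^bsub>M\<^esub>, y) \<in> rels" using gens_mem_rels by simp
  then show ?thesis using rels_uminus by force
qed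

text \<open>
  Moving the scalar across, \<open>x \<otimes> r y = r x \<otimes> y = 0\<close>.
\<close>

lemma annihilated_pure_tensor:
  assumes "r \<in> carrier R" "x \<in> carrier M" "y \<in> carrier N" "r \<odot>\<^bsub>M\<^esub> x = \<zero>\<^bsub>M\<^esub>"
  shows "frag_of (x, r \<odot>\<^bsub>N\<^esub> y) \<in> rels"
proof -
  have "frag_of (r \<odot>\<^bsub>M\<^esub> x, y) - frag_of (x, r \<odot>\<^bsub>N\<^esub> y) \<in> tensor_gens R M N"
    unfolding tensor_gens_def using assms by blast
  from rels_diff[OF pure_tensor_zero_left[OF assms(3)] gens_mem_rels[OF this]]
  show ?thesis using assms(4) by simp
qed

lemma rels_coset_eq_iff:
  assumes "Poly_Mapping.keys c \<subseteq> carrier M \<times> carrier N"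
  shows "rels #>\<^bsub>F\<^esub> c = rels \<longleftrightarrow> c \<in> rels"
  using group.coset_join1[OF group_free_Abelian_group _ _ subgroup_rels]
    group.coset_join2[OF group_free_Abelian_group _ subgroup_rels] assms by auto

lemma carrier_tensor:
  "carrier (tensor R M N) = {rels #>\<^bsub>F\<^esub> c | c. Poly_Mapping.keys c \<subseteq> carrier M \<times> carrier N}"
  by (auto simp: tensor_def RCOSETS_def)

lemma carrier_tensor_trivial_iff:
  "carrier (tensor R M N) = {rels} \<longleftrightarrow>
    (\<forall>x\<in>carrier M. \<forall>y\<in>carrier N. frag_of (x, y) \<in> rels)"
proof
  assume triv: "carrier (tensor R M N) = {rels}"
  show "\<forall>x\<in>carrier M. \<forall>y\<in>carrier N. frag_of (x, y) \<in> rels"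
  proof (intro ballI)
    fix x y assume "x \<in> carrier M" "y \<in> carrier N"
    then have k: "Poly_Mapping.keys (frag_of (x, y)) \<subseteq> carrier M \<times> carrier N" by simp
    then have "rels #>\<^bsub>F\<^esub> frag_of (x, y) \<in> carrier (tensor R M N)"
      unfolding carrier_tensor by blast
    then show "frag_of (x, y) \<in> rels" using triv rels_coset_eq_iff[OF k] by simp
  qed
next
  assume pure: "\<forall>x\<in>carrier M. \<forall>y\<in>carrier N. frag_of (x, y) \<in> rels"
  have "c \<in> rels" if "Poly_Mapping.keys c \<subseteq> carrier M \<times> carrier N" for c
    using that
    by (induction c rule: frag_induction) (use pure rels_diff zero_mem_rels in auto)
  then have *: "rels #>\<^bsub>F\<^esub> c = rels" if "Poly_Mapping.keys c \<subseteq> carrier M \<times> carrier N" for c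
    using that rels_coset_eq_iff by blast
  have "rels \<in> carrier (tensor R M N)"
    unfolding carrier_tensor using *[of 0] by fastforce
  then show "carrier (tensor R M N) = {rels}"
    unfolding carrier_tensor using * by auto
qed

lemma rels_mem_carrier_tensor: "rels \<in> carrier (tensor R M N)"
  unfolding carrier_tensor using rels_coset_eq_iff[of 0] zero_mem_rels by fastforce

end

lemma tensor_map_coset:
  fixes M :: "('a, 'm, 'x) module_scheme" and N :: "('a, 'n, 'y) module_scheme"
    and N' :: "('a, 'k, 'z) module_scheme"
  assumes "module R M" "module R N" "module R N'" and f: "f \<in> mod_hom R N N'"
    and c: "Poly_Mapping.keys c \<subseteq> carrier M \<times> carrier N"
  shows "tensor_map R M N' f (tensor_rels R M N #>\<^bsub>free_pairs M N\<^esub> c) =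
    tensor_rels R M N' #>\<^bsub>free_pairs M N'\<^esub> frag_extend (\<lambda>(x, y). frag_of (x, f y)) c"
    and "Poly_Mapping.keys (frag_extend (\<lambda>(x, y). frag_of (x, f y)) c) \<subseteq> carrier M \<times> carrier N'"
proof -
  interpret MN: module_pair R M N using assms by (simp add: module_pair_def)
  interpret MN': module_pair R M N' using assms by (simp add: module_pair_def)
  let ?\<Phi> = "frag_extend (\<lambda>(x :: 'm, y). frag_of (x, f y))"
  have fN: "f y \<in> carrier N'" if "y \<in> carrier N" for y
    using f that by (auto simp: mod_hom_def)
  have keys: "Poly_Mapping.keys (?\<Phi> d) \<subseteq> carrier M \<times> carrier N'"
    if d: "Poly_Mapping.keys d \<subseteq> carrier M \<times> carrier N" for d :: "'m \<times> 'n \<Rightarrow>\<^sub>0 int"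
  proof -
    have "Poly_Mapping.keys (case p of (x, y) \<Rightarrow> frag_of (x, f y)) \<subseteq> carrier M \<times> carrier N'"
      if "p \<in> Poly_Mapping.keys d" for p
      using subsetD[OF d that] fN by (cases p) simp
    then show ?thesis
      using keys_frag_extend[of "\<lambda>(x, y). frag_of (x, f y)" d] by (meson UN_least order_trans)
  qed
  then show "Poly_Mapping.keys (?\<Phi> c) \<subseteq> carrier M \<times> carrier N'" using c by blast
  have "tensor_gens R M N \<subseteq> {d. Poly_Mapping.keys d \<subseteq> carrier M \<times> carrier N \<and> ?\<Phi> d \<in> MN'.rels}"
  proof
    fix d assume d: "d \<in> tensor_gens R M N"
    then have "?\<Phi> d \<in> tensor_gens R M N'"
    proof -
      from d show ?thesis
      proof (cases rule: tensor_gensE)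
        case (left x x' y)
        then have "?\<Phi> d = frag_of (x \<oplus>\<^bsub>M\<^esub> x', f y) - frag_of (x, f y) - frag_of (x', f y)"
          by (simp add: frag_extend_diff)
        then show ?thesis unfolding tensor_gens_def using left fN by blast
      next
        case (right x y y')
        then have "?\<Phi> d = frag_of (x, f y \<oplus>\<^bsub>N'\<^esub> f y') - frag_of (x, f y) - frag_of (x, f y')"
          using f by (simp add: frag_extend_diff mod_hom_def)
        then show ?thesis unfolding tensor_gens_def using right fN by blast
      next
        case (scalar r x y)
        then have "?\<Phi> d = frag_of (r \<odot>\<^bsub>M\<^esub> x, f y) - frag_of (x, r \<odot>\<^bsub>N'\<^esub> f y)"
          using f by (simp add: frag_extend_diff mod_hom_def)
        then show ?thesis unfolding tensor_gens_def using scalar fN by blast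
      qed
    qed
    then show "d \<in> {d. Poly_Mapping.keys d \<subseteq> carrier M \<times> carrier N \<and> ?\<Phi> d \<in> MN'.rels}"
      using MN'.gens_mem_rels subsetD[OF MN.tensor_gens_subset d] by simp
  qed
  then have "MN.rels \<subseteq> {d. Poly_Mapping.keys d \<subseteq> carrier M \<times> carrier N \<and> ?\<Phi> d \<in> MN'.rels}"
    by (intro MN.rels_subset)
      (simp_all add: frag_extend_diff MN'.zero_mem_rels MN'.rels_diff keys_diff_subset)
  then have rels: "?\<Phi> d \<in> MN'.rels" if "d \<in> MN.rels" for d using that by blast
  have "tensor_map R M N' f (MN.rels #>\<^bsub>MN.F\<^esub> c) =
      {s + ?\<Phi> (d + c) | s d. s \<in> MN'.rels \<and> d \<in> MN.rels}"
    unfolding tensor_map_def by (auto simp: set_mult_def r_coset_def)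
  also have "\<dots> = {s + ?\<Phi> c | s. s \<in> MN'.rels}" (is "?A = ?B")
  proof
    show "?A \<subseteq> ?B"
    proof
      fix z assume "z \<in> ?A"
      then obtain s d where sd: "s \<in> MN'.rels" "d \<in> MN.rels" "z = s + ?\<Phi> (d + c)" by blast
      then have "z = (s + ?\<Phi> d) + ?\<Phi> c" by (simp add: frag_extend_add add.assoc)
      then show "z \<in> ?B" using MN'.rels_add[OF sd(1) rels[OF sd(2)]] by blast
    qed
    show "?B \<subseteq> ?A" using MN.zero_mem_rels by force
  qed
  also have "\<dots> = MN'.rels #>\<^bsub>MN'.F\<^esub> ?\<Phi> c" by (auto simp: r_coset_def)
  finally show "tensor_map R M N' f (MN.rels #>\<^bsub>MN.F\<^esub> c) = MN'.rels #>\<^bsub>MN'.F\<^esub> ?\<Phi> c" .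
qed

lemma tensor_map_carrier:
  assumes "module R M" "module R N" "module R N'" and f: "f \<in> mod_hom R N N'"
  shows "tensor_map R M N' f ` carrier (tensor R M N) \<subseteq> carrier (tensor R M N')"
    and "tensor_map R M N' f (tensor_rels R M N) = tensor_rels R M N'"
proof -
  interpret MN: module_pair R M N using assms by (simp add: module_pair_def)
  interpret MN': module_pair R M N' using assms by (simp add: module_pair_def)
  show "tensor_map R M N' f ` carrier (tensor R M N) \<subseteq> carrier (tensor R M N')"
  proof (rule image_subsetI)
    fix X assume "X \<in> carrier (tensor R M N)"
    then obtain c where c: "Poly_Mapping.keys c \<subseteq> carrier M \<times> carrier N"
      and X: "X = MN.rels #>\<^bsub>MN.F\<^esub> c" unfolding MN.carrier_tensor by blast
    show "tensor_map R M N' f X \<in> carrier (tensor R M N')"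
      unfolding X tensor_map_coset(1)[OF assms c] MN'.carrier_tensor
      using tensor_map_coset(2)[OF assms c] by blast
  qed
  show "tensor_map R M N' f (tensor_rels R M N) = tensor_rels R M N'"
    using tensor_map_coset(1)[OF assms, of 0] MN.rels_coset_eq_iff[of 0] MN'.rels_coset_eq_iff[of 0]
      MN.zero_mem_rels MN'.zero_mem_rels by simp
qed

text \<open>
  The map \<open>(R/I) \<otimes> N \<rightarrow> N/H\<close> with \<open>(r + I) \<otimes> y \<mapsto> r y + H\<close> is well defined as \<open>I N \<subseteq> H\<close>, and it
  sends \<open>1 \<otimes> y\<close> to \<open>y + H\<close>. To stay with elements of \<open>N\<close>, the proof chooses representatives of
  cosets and works modulo \<open>H\<close> throughout: the homomorphism from the free abelian group defined by
  \<open>(r + I, y) \<mapsto> r y\<close> maps all bilinearity relations into \<open>H\<close>.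
\<close>

lemma (in ideal) quot_tensor_vanishing:
  assumes "cring R" "module R N" and H: "submodule H R N"
    and IH: "\<And>i y. i \<in> I \<Longrightarrow> y \<in> carrier N \<Longrightarrow> i \<odot>\<^bsub>N\<^esub> y \<in> H"
    and y: "y \<in> carrier N"
    and van: "frag_of (I +> \<one>, y) \<in> tensor_rels R (quot_module (self_module R) I) N"
  shows "y \<in> H"
proof -
  let ?Q = "quot_module (self_module R) I"
  interpret R: cring R by fact
  interpret module_pair R ?Q N using assms(1,2) quot_module by (simp add: module_pair_def)
  note HN = N.submoduleE[OF H]
  have Hz: "\<zero>\<^bsub>N\<^esub> \<in> H" by (rule submodule_zero_mem[OF H])
  define rep where "rep X = (SOME r. r \<in> carrier R \<and> X = I +> r)" for X
  have rep: "rep X \<in> carrier R" "X = I +> rep X" if "X \<in> carrier ?Q" for X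
  proof -
    have "\<exists>r. r \<in> carrier R \<and> X = I +> r" using that by (auto simp: quot_module_simps)
    from someI_ex[OF this] show "rep X \<in> carrier R" "X = I +> rep X"
      unfolding rep_def by blast+
  qed
  have rep_cong: "rep X \<odot>\<^bsub>N\<^esub> y \<ominus>\<^bsub>N\<^esub> r \<odot>\<^bsub>N\<^esub> y \<in> H"
    if X: "X \<in> carrier ?Q" "r \<in> carrier R" "X = I +> r" and y: "y \<in> carrier N" for X r y
  proof -
    have "rep X \<ominus> r \<in> I" using coset_eq_iff[of "rep X" r] rep[OF X(1)] X by metis
    then have "(rep X \<ominus> r) \<odot>\<^bsub>N\<^esub> y \<in> H" using IH y by blast
    then show ?thesis
      using rep(1)[OF X(1)] X(2) y by (simp add: minus_eq N.minus_eq N.smult_l_distr N.smult_l_minus)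
  qed
  obtain h where h: "h \<in> hom F (add_monoid N)"
    and h_pure: "\<And>p. p \<in> carrier ?Q \<times> carrier N \<Longrightarrow> h (frag_of p) = rep (fst p) \<odot>\<^bsub>N\<^esub> snd p"
  proof (rule comm_group.free_Abelian_group_universal[OF N.a_comm_group])
    show "(\<lambda>p. rep (fst p) \<odot>\<^bsub>N\<^esub> snd p) ` (carrier ?Q \<times> carrier N) \<subseteq> carrier (add_monoid N)"
      using rep by auto
  qed blast
  interpret h: group_hom F "add_monoid N" h
    using h by (simp add: group_hom_def group_hom_axioms_def N.a_group)
  have h_closed: "h c \<in> carrier N" if "Poly_Mapping.keys c \<subseteq> carrier ?Q \<times> carrier N" for c
    using h.hom_closed[of c] that by simp
  have h_zero: "h 0 = \<zero>\<^bsub>N\<^esub>" using h.hom_one by simp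
  have h_diff: "h (c - d) = h c \<ominus>\<^bsub>N\<^esub> h d"
    if "Poly_Mapping.keys c \<subseteq> carrier ?Q \<times> carrier N" "Poly_Mapping.keys d \<subseteq> carrier ?Q \<times> carrier N" for c d
    using h.hom_mult[of c "- d"] h.hom_inv[of d] that by (simp add: N.minus_eq a_inv_def)
  have "rels \<subseteq> {c. Poly_Mapping.keys c \<subseteq> carrier ?Q \<times> carrier N \<and> h c \<in> H}"
  proof (rule rels_subset)
    fix a b assume "a \<in> {c. Poly_Mapping.keys c \<subseteq> carrier ?Q \<times> carrier N \<and> h c \<in> H}"
      "b \<in> {c. Poly_Mapping.keys c \<subseteq> carrier ?Q \<times> carrier N \<and> h c \<in> H}"
    then show "a - b \<in> {c. Poly_Mapping.keys c \<subseteq> carrier ?Q \<times> carrier N \<and> h c \<in> H}"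
      using keys_diff_subset[of a "carrier ?Q \<times> carrier N" b] h_diff[of a b] HN(3,5)
      by (simp add: N.minus_eq)
  next
    show "tensor_gens R ?Q N \<subseteq> {c. Poly_Mapping.keys c \<subseteq> carrier ?Q \<times> carrier N \<and> h c \<in> H}"
    proof
      fix d assume d: "d \<in> tensor_gens R ?Q N"
      then have "h d \<in> H"
      proof (cases rule: tensor_gensE)
        case (left x x' y)
        note r = rep[OF left(1)] rep[OF left(2)]
        have "x \<oplus>\<^bsub>?Q\<^esub> x' = (I +> rep x) \<oplus>\<^bsub>?Q\<^esub> (I +> rep x')" using r(2,4) by simp
        also have "\<dots> = I +> (rep x \<oplus> rep x')"
          using r(1,3) by (simp add: quot_module_simps a_rcos_sum)
        finally have sum: "x \<oplus>\<^bsub>?Q\<^esub> x' = I +> (rep x \<oplus> rep x')" .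
        have "rep (x \<oplus>\<^bsub>?Q\<^esub> x') \<odot>\<^bsub>N\<^esub> y \<ominus>\<^bsub>N\<^esub> (rep x \<oplus> rep x') \<odot>\<^bsub>N\<^esub> y \<in> H"
          by (rule rep_cong[OF M.a_closed[OF left(1,2)] _ sum left(3)]) (use r(1,3) in simp)
        moreover have "h d = rep (x \<oplus>\<^bsub>?Q\<^esub> x') \<odot>\<^bsub>N\<^esub> y \<ominus>\<^bsub>N\<^esub> rep x \<odot>\<^bsub>N\<^esub> y \<ominus>\<^bsub>N\<^esub> rep x' \<odot>\<^bsub>N\<^esub> y"
          using left by (simp add: h_diff h_pure keys_diff_subset)
        moreover have "rep (x \<oplus>\<^bsub>?Q\<^esub> x') \<in> carrier R" using left by (intro rep) simp
        ultimately show ?thesis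
          using r(1,3) left(3)
          by (simp add: N.minus_eq N.smult_l_distr N.minus_add N.a_assoc)
      next
        case (right x y y')
        then have "h d = rep x \<odot>\<^bsub>N\<^esub> (y \<oplus>\<^bsub>N\<^esub> y') \<ominus>\<^bsub>N\<^esub> rep x \<odot>\<^bsub>N\<^esub> y \<ominus>\<^bsub>N\<^esub> rep x \<odot>\<^bsub>N\<^esub> y'"
          by (simp add: h_diff h_pure keys_diff_subset)
        also have "\<dots> = \<zero>\<^bsub>N\<^esub>"
        proof -
          define u v where "u = rep x \<odot>\<^bsub>N\<^esub> y" and "v = rep x \<odot>\<^bsub>N\<^esub> y'"
          have "u \<in> carrier N" "v \<in> carrier N" "rep x \<odot>\<^bsub>N\<^esub> (y \<oplus>\<^bsub>N\<^esub> y') = u \<oplus>\<^bsub>N\<^esub> v"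
            using right(1-3) rep(1)[OF right(1)] by (simp_all add: u_def v_def N.smult_r_distr)
          then show ?thesis
            unfolding u_def[symmetric] v_def[symmetric]
            using N.r_neg[of "u \<oplus>\<^bsub>N\<^esub> v"] by (simp add: N.minus_eq N.minus_add N.a_assoc)
        qed
        finally show ?thesis using Hz by simp
      next
        case (scalar r x y)
        note r = rep[OF scalar(2)]
        have "r \<odot>\<^bsub>?Q\<^esub> x = r \<odot>\<^bsub>?Q\<^esub> (I +> rep x)" using r(2) by simp
        also have "\<dots> = I +> (r \<otimes> rep x)" using r(1) scalar(1) by (simp add: quot_smult)
        finally have prod: "r \<odot>\<^bsub>?Q\<^esub> x = I +> (r \<otimes> rep x)" .
        have "rep (r \<odot>\<^bsub>?Q\<^esub> x) \<odot>\<^bsub>N\<^esub> y \<ominus>\<^bsub>N\<^esub> (r \<otimes> rep x) \<odot>\<^bsub>N\<^esub> y \<in> H"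
          by (rule rep_cong[OF M.smult_closed[OF scalar(1,2)] _ prod scalar(3)])
            (use r(1) scalar(1) in simp)
        moreover have "h d = rep (r \<odot>\<^bsub>?Q\<^esub> x) \<odot>\<^bsub>N\<^esub> y \<ominus>\<^bsub>N\<^esub> rep x \<odot>\<^bsub>N\<^esub> (r \<odot>\<^bsub>N\<^esub> y)"
          using scalar by (simp add: h_diff h_pure)
        moreover have "(r \<otimes> rep x) \<odot>\<^bsub>N\<^esub> y = rep x \<odot>\<^bsub>N\<^esub> (r \<odot>\<^bsub>N\<^esub> y)"
          using r(1) scalar(1,3) N.smult_assoc1[of "rep x" r y] R.m_comm[of r "rep x"] by simp
        ultimately show ?thesis by simp
      qed
      then show "d \<in> {c. Poly_Mapping.keys c \<subseteq> carrier ?Q \<times> carrier N \<and> h c \<in> H}"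
        using subsetD[OF tensor_gens_subset d] by simp
    qed
  qed (use h_zero Hz in auto)
  then have "h (frag_of (I +> \<one>, y)) \<in> H" using van by blast
  moreover have one: "I +> \<one> \<in> carrier ?Q" by (simp add: quot_module_simps)
  ultimately have "rep (I +> \<one>) \<odot>\<^bsub>N\<^esub> y \<in> H" using h_pure[of "(I +> \<one>, y)"] y by simp
  moreover have "rep (I +> \<one>) \<odot>\<^bsub>N\<^esub> y \<ominus>\<^bsub>N\<^esub> \<one> \<odot>\<^bsub>N\<^esub> y \<in> H"
    using one y by (intro rep_cong) auto
  ultimately have "rep (I +> \<one>) \<odot>\<^bsub>N\<^esub> y \<ominus>\<^bsub>N\<^esub> (rep (I +> \<one>) \<odot>\<^bsub>N\<^esub> y \<ominus>\<^bsub>N\<^esub> \<one> \<odot>\<^bsub>N\<^esub> y) \<in> H"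
    using HN by (simp add: N.minus_eq)
  moreover have "u \<ominus>\<^bsub>N\<^esub> (u \<ominus>\<^bsub>N\<^esub> y) = y" if "u \<in> carrier N" for u
    using that y by (simp add: N.minus_eq N.minus_add N.r_neg2)
  ultimately show ?thesis using rep(1)[OF one] y by simp
qed

section \<open>Absolutely flat rings are von Neumann regular\<close>

lemma (in cring) ideal_imp_submodule_self:
  assumes "ideal J R"
  shows "submodule J R (self_module R)"
proof -
  interpret S: module R "self_module R" by (rule self_module)
  interpret J: ideal J R by fact
  show ?thesis
    by (rule S.submoduleI_smult)
      (use J.Icarr J.I_l_closed J.a_closed additive_subgroup.zero_closed[OF J.is_additive_subgroup] in auto)
qed

lemma (in cring) ideal_module:
  assumes "ideal J R"
  shows "module R ((self_module R)\<lparr>carrier := J\<rparr>)"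
  by (rule submodule.submodule_is_module[OF ideal_imp_submodule_self[OF assms] self_module])

lemma (in cring) inclusion_mod_hom:
  assumes "ideal J R"
  shows "(\<lambda>x. x) \<in> mod_hom R ((self_module R)\<lparr>carrier := J\<rparr>) (self_module R)"
  using ideal.Icarr[OF assms] by (auto simp: mod_hom_def)

text \<open>
  Tensor the inclusion \<open>Ra \<rightarrow> R\<close> with the flat module \<open>R/Ra\<close>. In \<open>R/Ra \<otimes> R\<close> the element
  \<open>1 \<otimes> a = a \<otimes> 1\<close> is zero, so it is already zero in \<open>R/Ra \<otimes> Ra\<close>. The canonical map to
  \<open>Ra/Ra\<^sup>2\<close> then shows \<open>a \<in> Ra\<^sup>2\<close>.
\<close>

lemma absolutely_flat_imp_regular:
  assumes "cring R" and flat: "absolutely_flat R"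
  shows "regular_cring R"
proof -
  interpret cring R by fact
  show ?thesis
  proof
    fix a assume a: "a \<in> carrier R"
    let ?I = "PIdl\<^bsub>R\<^esub> a" and ?H = "PIdl\<^bsub>R\<^esub> (a \<otimes>\<^bsub>R\<^esub> a)"
    let ?A = "(self_module R)\<lparr>carrier := ?I\<rparr>" and ?B = "self_module R"
    have I: "ideal ?I R" and H: "ideal ?H R" by (simp_all add: cgenideal_ideal a)
    have aI: "a \<in> ?I" by (rule cgenideal_self[OF a])
    interpret I: ideal ?I R by (rule I)
    interpret H: ideal ?H R by (rule H)
    let ?Q = "quot_module (self_module R) ?I"
    have Q: "module R ?Q" by (rule I.quot_module[OF is_cring])
    have A: "module R ?A" by (rule ideal_module[OF I])
    interpret QA: module_pair R ?Q ?A using Q A by (simp add: module_pair_def)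
    interpret QB: module_pair R ?Q ?B using Q self_module by (simp add: module_pair_def)
    note inc = inclusion_mod_hom[OF I]
    have "flat_module TYPE('a) R ?Q" using flat Q unfolding absolutely_flat_def by blast
    then have inj: "inj_on (tensor_map R ?Q ?B (\<lambda>x. x)) (carrier (tensor R ?Q ?A))"
      using A self_module inc inj_on_id2 unfolding flat_module_def by blast
    let ?one = "?I +>\<^bsub>R\<^esub> \<one>\<^bsub>R\<^esub>"
    have one: "?one \<in> carrier ?Q" by (auto simp: I.quot_module_simps)
    have ann: "a \<odot>\<^bsub>?Q\<^esub> ?one = \<zero>\<^bsub>?Q\<^esub>"
      using I.quot_smult[OF a, of "\<one>\<^bsub>R\<^esub>"] a aI
      by (simp add: I.quot_module_simps I.coset_eq_zero_iff)
    have k: "Poly_Mapping.keys (frag_of (?one, a)) \<subseteq> carrier ?Q \<times> carrier ?A"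
      "Poly_Mapping.keys (frag_of (?one, a)) \<subseteq> carrier ?Q \<times> carrier ?B"
      using one a aI by simp_all
    have "frag_of (?one, a \<odot>\<^bsub>?B\<^esub> \<one>\<^bsub>R\<^esub>) \<in> QB.rels"
      by (rule QB.annihilated_pure_tensor[OF a one _ ann]) simp
    then have "QB.rels #>\<^bsub>QB.F\<^esub> frag_of (?one, a) = QB.rels"
      using QB.rels_coset_eq_iff[OF k(2)] a by simp
    then have "tensor_map R ?Q ?B (\<lambda>x. x) (QA.rels #>\<^bsub>QA.F\<^esub> frag_of (?one, a)) =
        tensor_map R ?Q ?B (\<lambda>x. x) QA.rels"
      unfolding tensor_map_carrier(2)[OF Q A self_module inc]
        tensor_map_coset(1)[OF Q A self_module inc k(1)]
      by simp
    moreover have "QA.rels #>\<^bsub>QA.F\<^esub> frag_of (?one, a) \<in> carrier (tensor R ?Q ?A)"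
      unfolding QA.carrier_tensor using k(1) by blast
    ultimately have "QA.rels #>\<^bsub>QA.F\<^esub> frag_of (?one, a) = QA.rels"
      using inj_onD[OF inj] QA.rels_mem_carrier_tensor by blast
    then have "frag_of (?one, a) \<in> QA.rels"
      using QA.rels_coset_eq_iff[OF k(1)] by blast
    have *: "i \<otimes>\<^bsub>R\<^esub> y \<in> ?H" if "i \<in> ?I" "y \<in> ?I" for i y
    proof -
      obtain r where r: "r \<in> carrier R" "y = r \<otimes>\<^bsub>R\<^esub> a"
        using \<open>y \<in> ?I\<close> unfolding cgenideal_def by blast
      obtain s where s: "s \<in> carrier R" "i = s \<otimes>\<^bsub>R\<^esub> a"
        using \<open>i \<in> ?I\<close> unfolding cgenideal_def by blast
      have "i \<otimes>\<^bsub>R\<^esub> y = (s \<otimes>\<^bsub>R\<^esub> r) \<otimes>\<^bsub>R\<^esub> (a \<otimes>\<^bsub>R\<^esub> a)"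
        unfolding r(2) s(2) using a r(1) s(1) by (simp add: m_ac)
      then show ?thesis using r(1) s(1) unfolding cgenideal_def by blast
    qed
    have "?H \<subseteq> ?I"
    proof
      fix x assume "x \<in> ?H"
      then obtain r where r: "r \<in> carrier R" "x = r \<otimes>\<^bsub>R\<^esub> (a \<otimes>\<^bsub>R\<^esub> a)"
        unfolding cgenideal_def by blast
      show "x \<in> ?I" unfolding r(2) by (rule I.I_l_closed[OF I.I_l_closed[OF aI a] r(1)])
    qed
    then have "submodule ?H R ?A"
      by (intro QA.N.submoduleI_smult)
        (use H.I_l_closed H.a_closed additive_subgroup.zero_closed[OF H.is_additive_subgroup] in auto)
    then have "a \<in> ?H"
      using I.quot_tensor_vanishing[OF is_cring A _ _ _ \<open>frag_of (?one, a) \<in> QA.rels\<close>] * aI by simp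
    then obtain x where x: "x \<in> carrier R" "a = x \<otimes>\<^bsub>R\<^esub> (a \<otimes>\<^bsub>R\<^esub> a)"
      unfolding cgenideal_def by blast
    have "x \<otimes>\<^bsub>R\<^esub> (a \<otimes>\<^bsub>R\<^esub> a) = a \<otimes>\<^bsub>R\<^esub> a \<otimes>\<^bsub>R\<^esub> x"
      using a x(1) by (intro m_comm) auto
    then show "\<exists>x\<in>carrier R. a = a \<otimes>\<^bsub>R\<^esub> a \<otimes>\<^bsub>R\<^esub> x"
      using x by metis
  qed
qed

section \<open>Baer's criterion\<close>

lemma injective_module_extend_ideal:
  fixes R :: "('a, 'r) ring_scheme" and E :: "('a, 'e, 'y) module_scheme"
  assumes inj: "injective_module TYPE('a) R E" and J: "ideal J R"
    and f: "f \<in> mod_hom R ((self_module R)\<lparr>carrier := J\<rparr>) E"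
  shows "\<exists>y\<in>carrier E. \<forall>x\<in>J. f x = x \<odot>\<^bsub>E\<^esub> y"
proof -
  interpret E: module R E using inj by (simp add: injective_module_def)
  interpret J: ideal J R by fact
  obtain g where g: "g \<in> mod_hom R (self_module R) E" "\<forall>x\<in>J. g x = f x"
  proof -
    have "\<exists>g\<in>mod_hom R (self_module R) E. \<forall>x\<in>carrier ((self_module R)\<lparr>carrier := J\<rparr>). g x = f x"
      using inj E.ideal_module[OF J] E.self_module E.inclusion_mod_hom[OF J] f inj_on_id2
      unfolding injective_module_def by blast
    then show ?thesis using that by auto
  qed
  have "f x = x \<odot>\<^bsub>E\<^esub> g \<one>\<^bsub>R\<^esub>" if x: "x \<in> J" for x
  proof -
    have "g (x \<otimes>\<^bsub>R\<^esub> \<one>\<^bsub>R\<^esub>) = x \<odot>\<^bsub>E\<^esub> g \<one>\<^bsub>R\<^esub>"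
      using g(1) J.Icarr[OF x] E.R.one_closed
      unfolding mod_hom_def self_module_simps mem_Collect_eq by blast
    then show ?thesis using g(2) x J.Icarr[OF x] by simp
  qed
  moreover have "g \<one>\<^bsub>R\<^esub> \<in> carrier E" using g(1) by (auto simp: mod_hom_def)
  ultimately show ?thesis by blast
qed

text \<open>
  By Zorn's lemma there is a maximal extension of \<open>f\<close> to a submodule of \<open>B\<close> containing \<open>i(A)\<close>.
  If \<open>b\<close> is any element of \<open>B\<close>, the extension restricts to the multiples \<open>r b\<close> with \<open>r\<close> in the
  ideal \<open>J\<close> of those \<open>r\<close> for which \<open>r b\<close> is in its domain. This partial map is \<open>r b \<mapsto> r y\<close> for some
  \<open>y \<in> E\<close>, and \<open>b \<mapsto> y\<close> extends the map further; so \<open>b\<close> was in the domain already.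
\<close>
theorem baer_criterion:
  fixes R :: "('a, 'r) ring_scheme" and E :: "('a, 'e, 'y) module_scheme"
  assumes "module R E"
    and baer: "\<And>J f. ideal J R \<Longrightarrow> f \<in> mod_hom R ((self_module R)\<lparr>carrier := J\<rparr>) E \<Longrightarrow>
      \<exists>y\<in>carrier E. \<forall>x\<in>J. f x = x \<odot>\<^bsub>E\<^esub> y"
  shows "injective_module TYPE('t) R E"
  unfolding injective_module_def
proof (intro conjI allI impI; (elim conjE)?)
  fix A B :: "('a, 't) module" and i f
  assume "module R A" "module R B" and i: "i \<in> mod_hom R A B" "inj_on i (carrier A)"
    and f: "f \<in> mod_hom R A E"
  interpret A: module R A by fact
  interpret B: module R B by fact
  interpret E: module R E by fact
  have iB: "i x \<in> carrier B" and fE: "f x \<in> carrier E" if "x \<in> carrier A" for x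
    using i f that by (auto simp: mod_hom_def)
  \<comment> \<open>Partial extensions are represented by their graphs, so that they are ordered by inclusion.
    The last condition says that the graph is single-valued.\<close>
  define \<G> where "\<G> = {G. G \<subseteq> carrier B \<times> carrier E \<and> (\<forall>x\<in>carrier A. (i x, f x) \<in> G) \<and>
    (\<forall>b e b' e'. (b, e) \<in> G \<longrightarrow> (b', e') \<in> G \<longrightarrow> (b \<oplus>\<^bsub>B\<^esub> b', e \<oplus>\<^bsub>E\<^esub> e') \<in> G) \<and>
    (\<forall>r\<in>carrier R. \<forall>b e. (b, e) \<in> G \<longrightarrow> (r \<odot>\<^bsub>B\<^esub> b, r \<odot>\<^bsub>E\<^esub> e) \<in> G) \<and>
    (\<forall>e. (\<zero>\<^bsub>B\<^esub>, e) \<in> G \<longrightarrow> e = \<zero>\<^bsub>E\<^esub>)}"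
  have "\<exists>G\<in>\<G>. \<forall>X\<in>\<G>. G \<subseteq> X \<longrightarrow> X = G"
  proof (rule subset_Zorn_nonempty)
    define G0 where "G0 = (\<lambda>x. (i x, f x)) ` carrier A"
    have G0: "\<exists>x\<in>carrier A. b = i x \<and> e = f x" if "(b, e) \<in> G0" for b e
      using that by (auto simp: G0_def)
    have G0I: "(i x, f x) \<in> G0" if "x \<in> carrier A" for x
      using that by (simp add: G0_def)
    have "(b \<oplus>\<^bsub>B\<^esub> b', e \<oplus>\<^bsub>E\<^esub> e') \<in> G0" if be: "(b, e) \<in> G0" "(b', e') \<in> G0" for b e b' e'
    proof -
      obtain x x' where x: "x \<in> carrier A" "b = i x" "e = f x" "x' \<in> carrier A" "b' = i x'" "e' = f x'"
        using G0[OF be(1)] G0[OF be(2)] by blast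
      then show ?thesis using G0I[OF A.a_closed[OF x(1,4)]] i(1) f by (simp add: mod_hom_def)
    qed
    moreover have "(r \<odot>\<^bsub>B\<^esub> b, r \<odot>\<^bsub>E\<^esub> e) \<in> G0" if r: "r \<in> carrier R" and be: "(b, e) \<in> G0" for r b e
    proof -
      obtain x where x: "x \<in> carrier A" "b = i x" "e = f x" using G0[OF be] by blast
      then show ?thesis using G0I[OF A.smult_closed[OF r x(1)]] i(1) f r by (simp add: mod_hom_def)
    qed
    moreover have "e = \<zero>\<^bsub>E\<^esub>" if be: "(\<zero>\<^bsub>B\<^esub>, e) \<in> G0" for e
    proof -
      obtain x where x: "x \<in> carrier A" "\<zero>\<^bsub>B\<^esub> = i x" "e = f x" using G0[OF be] by blast
      have "i (\<zero>\<^bsub>R\<^esub> \<odot>\<^bsub>A\<^esub> x) = \<zero>\<^bsub>R\<^esub> \<odot>\<^bsub>B\<^esub> i x" "f (\<zero>\<^bsub>R\<^esub> \<odot>\<^bsub>A\<^esub> x) = \<zero>\<^bsub>R\<^esub> \<odot>\<^bsub>E\<^esub> f x"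
        using i(1) f x(1) unfolding mod_hom_def by blast+
      then have z: "i \<zero>\<^bsub>A\<^esub> = \<zero>\<^bsub>B\<^esub>" "f \<zero>\<^bsub>A\<^esub> = \<zero>\<^bsub>E\<^esub>" using x(1) iB fE by simp_all
      have "i x = i \<zero>\<^bsub>A\<^esub>" using x(2) z(1) by metis
      then have "x = \<zero>\<^bsub>A\<^esub>" by (rule inj_onD[OF i(2) _ x(1) A.zero_closed])
      then show ?thesis using z x(3) by simp
    qed
    moreover have "G0 \<subseteq> carrier B \<times> carrier E" using iB fE by (auto simp: G0_def)
    ultimately have "G0 \<in> \<G>" unfolding \<G>_def using G0I by simp
    then show "\<G> \<noteq> {}" by blast
  next
    fix \<C> assume \<C>: "\<C> \<noteq> {}" "subset.chain \<G> \<C>"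
    then obtain G1 where G1: "G1 \<in> \<C>" by blast
    have mem: "G \<in> \<G>" if "G \<in> \<C>" for G using \<C>(2) that by (auto simp: subset_chain_def)
    have pair: "\<exists>G\<in>\<C>. p \<in> G \<and> q \<in> G" if pq: "p \<in> \<Union>\<C>" "q \<in> \<Union>\<C>" for p q
    proof -
      obtain G where G: "G \<in> \<C>" "p \<in> G" using pq(1) by (rule UnionE)
      obtain G' where G': "G' \<in> \<C>" "q \<in> G'" using pq(2) by (rule UnionE)
      have "G \<subseteq> G' \<or> G' \<subseteq> G" using \<C>(2) G(1) G'(1) by (auto simp: subset_chain_def)
      then show ?thesis using G G' by blast
    qed
    show "\<Union>\<C> \<in> \<G>"
      unfolding \<G>_def mem_Collect_eq
    proof (intro conjI allI ballI impI)
      show "\<Union>\<C> \<subseteq> carrier B \<times> carrier E"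
        using mem unfolding \<G>_def mem_Collect_eq by (meson Union_least)
      show "(i x, f x) \<in> \<Union>\<C>" if "x \<in> carrier A" for x
        using mem[OF G1] G1 that unfolding \<G>_def mem_Collect_eq by blast
      show "(b \<oplus>\<^bsub>B\<^esub> b', e \<oplus>\<^bsub>E\<^esub> e') \<in> \<Union>\<C>" if be: "(b, e) \<in> \<Union>\<C>" "(b', e') \<in> \<Union>\<C>" for b e b' e'
      proof -
        obtain G where "G \<in> \<C>" "(b, e) \<in> G" "(b', e') \<in> G" using pair[OF be] by blast
        then show ?thesis using mem[of G] unfolding \<G>_def mem_Collect_eq by blast
      qed
      show "(r \<odot>\<^bsub>B\<^esub> b, r \<odot>\<^bsub>E\<^esub> e) \<in> \<Union>\<C>"
        if r: "r \<in> carrier R" and be: "(b, e) \<in> \<Union>\<C>" for r b e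
      proof -
        obtain G where "G \<in> \<C>" "(b, e) \<in> G" using be by (rule UnionE)
        then show ?thesis using mem[of G] r unfolding \<G>_def mem_Collect_eq by blast
      qed
      show "e = \<zero>\<^bsub>E\<^esub>" if e: "(\<zero>\<^bsub>B\<^esub>, e) \<in> \<Union>\<C>" for e
      proof -
        obtain G where "G \<in> \<C>" "(\<zero>\<^bsub>B\<^esub>, e) \<in> G" using e by (rule UnionE)
        then show ?thesis using mem[of G] unfolding \<G>_def mem_Collect_eq by blast
      qed
    qed
  qed
  then obtain G where G\<G>: "G \<in> \<G>" and maxG: "\<forall>X\<in>\<G>. G \<subseteq> X \<longrightarrow> X = G" ..
  have G_sub: "G \<subseteq> carrier B \<times> carrier E" and G_f: "\<And>x. x \<in> carrier A \<Longrightarrow> (i x, f x) \<in> G"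
    and G_add: "\<And>b e b' e'. (b, e) \<in> G \<Longrightarrow> (b', e') \<in> G \<Longrightarrow> (b \<oplus>\<^bsub>B\<^esub> b', e \<oplus>\<^bsub>E\<^esub> e') \<in> G"
    and G_smult: "\<And>r b e. r \<in> carrier R \<Longrightarrow> (b, e) \<in> G \<Longrightarrow> (r \<odot>\<^bsub>B\<^esub> b, r \<odot>\<^bsub>E\<^esub> e) \<in> G"
    and G_zero: "\<And>e. (\<zero>\<^bsub>B\<^esub>, e) \<in> G \<Longrightarrow> e = \<zero>\<^bsub>E\<^esub>"
    using G\<G> unfolding \<G>_def mem_Collect_eq by blast+
  have G_carr: "b \<in> carrier B" "e \<in> carrier E" if "(b, e) \<in> G" for b e
    using subsetD[OF G_sub that] by simp_all
  have G_uminus: "(\<ominus>\<^bsub>B\<^esub> b, \<ominus>\<^bsub>E\<^esub> e) \<in> G" if "(b, e) \<in> G" for b e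
    using G_smult[OF _ that, of "\<ominus>\<^bsub>R\<^esub> \<one>\<^bsub>R\<^esub>"] G_carr[OF that]
    by (simp add: B.smult_l_minus E.smult_l_minus)
  have G_unique: "e = e'" if e: "(b, e) \<in> G" "(b, e') \<in> G" for b e e'
  proof -
    have "(b \<oplus>\<^bsub>B\<^esub> \<ominus>\<^bsub>B\<^esub> b, e \<oplus>\<^bsub>E\<^esub> \<ominus>\<^bsub>E\<^esub> e') \<in> G" by (rule G_add[OF e(1) G_uminus[OF e(2)]])
    then have "e \<oplus>\<^bsub>E\<^esub> \<ominus>\<^bsub>E\<^esub> e' = \<zero>\<^bsub>E\<^esub>"
      using G_zero B.r_neg[OF G_carr(1)[OF e(1)]] by simp
    then show ?thesis
      using E.minus_equality[of e "\<ominus>\<^bsub>E\<^esub> e'"] G_carr(2)[OF e(1)] G_carr(2)[OF e(2)] by simp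
  qed
  have G_00: "(\<zero>\<^bsub>B\<^esub>, \<zero>\<^bsub>E\<^esub>) \<in> G"
    using G_smult[OF A.R.zero_closed G_f[OF A.zero_closed]] iB fE by simp
  have total: "\<exists>e. (b, e) \<in> G" if b: "b \<in> carrier B" for b
  proof -
    define J where "J = {r \<in> carrier R. \<exists>e. (r \<odot>\<^bsub>B\<^esub> b, e) \<in> G}"
    have J: "ideal J R"
    proof (rule A.idealI_comm)
      show "\<zero>\<^bsub>R\<^esub> \<in> J" using G_00 b by (auto simp: J_def)
      show "r \<oplus>\<^bsub>R\<^esub> s \<in> J" if "r \<in> J" "s \<in> J" for r s
        using that G_add b unfolding J_def by (auto simp: B.smult_l_distr) blast
      show "r \<otimes>\<^bsub>R\<^esub> s \<in> J" if "r \<in> carrier R" "s \<in> J" for r s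
        using that G_smult b unfolding J_def by (auto simp: B.smult_assoc1)
    qed (auto simp: J_def)
    define \<phi> where "\<phi> r = (THE e. (r \<odot>\<^bsub>B\<^esub> b, e) \<in> G)" for r
    have \<phi>_eq: "\<phi> r = e" if "(r \<odot>\<^bsub>B\<^esub> b, e) \<in> G" for r e
      unfolding \<phi>_def using that G_unique by blast
    have \<phi>: "(r \<odot>\<^bsub>B\<^esub> b, \<phi> r) \<in> G" if "r \<in> J" for r
      using that \<phi>_eq unfolding J_def by blast
    have JR: "r \<in> carrier R" if "r \<in> J" for r using that by (simp add: J_def)
    have "\<phi> \<in> mod_hom R ((self_module R)\<lparr>carrier := J\<rparr>) E"
    proof -
      have "\<phi> r \<in> carrier E" if "r \<in> J" for r using G_carr(2)[OF \<phi>[OF that]] .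
      moreover have "\<phi> (r \<oplus>\<^bsub>R\<^esub> s) = \<phi> r \<oplus>\<^bsub>E\<^esub> \<phi> s" if "r \<in> J" "s \<in> J" for r s
        using G_add[OF \<phi>[OF that(1)] \<phi>[OF that(2)]] JR that b
        by (intro \<phi>_eq) (simp add: B.smult_l_distr)
      moreover have "\<phi> (r \<otimes>\<^bsub>R\<^esub> s) = r \<odot>\<^bsub>E\<^esub> \<phi> s" if "r \<in> carrier R" "s \<in> J" for r s
        using G_smult[OF that(1) \<phi>[OF that(2)]] JR that b
        by (intro \<phi>_eq) (simp add: B.smult_assoc1)
      ultimately show ?thesis by (auto simp: mod_hom_def)
    qed
    from baer[OF J this] obtain y where y: "y \<in> carrier E" "\<forall>r\<in>J. \<phi> r = r \<odot>\<^bsub>E\<^esub> y" by blast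
    define G' where "G' = {(c \<oplus>\<^bsub>B\<^esub> r \<odot>\<^bsub>B\<^esub> b, e \<oplus>\<^bsub>E\<^esub> r \<odot>\<^bsub>E\<^esub> y) | c e r. (c, e) \<in> G \<and> r \<in> carrier R}"
    have G'I: "(c \<oplus>\<^bsub>B\<^esub> r \<odot>\<^bsub>B\<^esub> b, e \<oplus>\<^bsub>E\<^esub> r \<odot>\<^bsub>E\<^esub> y) \<in> G'" if "(c, e) \<in> G" "r \<in> carrier R" for c e r
      unfolding G'_def using that by blast
    have G'E: "\<exists>c e r. (c, e) \<in> G \<and> r \<in> carrier R \<and> u = c \<oplus>\<^bsub>B\<^esub> r \<odot>\<^bsub>B\<^esub> b \<and> v = e \<oplus>\<^bsub>E\<^esub> r \<odot>\<^bsub>E\<^esub> y"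
      if "(u, v) \<in> G'" for u v
      using that unfolding G'_def by blast
    have sub: "G \<subseteq> G'"
    proof
      fix p assume p: "p \<in> G"
      obtain c e where ce: "p = (c, e)" by (cases p)
      then show "p \<in> G'"
        using G'I[of c e "\<zero>\<^bsub>R\<^esub>"] p G_carr[of c e] b y(1) by simp
    qed
    have "G' \<in> \<G>"
      unfolding \<G>_def mem_Collect_eq
    proof (intro conjI allI ballI impI)
      show "G' \<subseteq> carrier B \<times> carrier E" unfolding G'_def using G_carr b y(1) by auto
      show "(i x, f x) \<in> G'" if "x \<in> carrier A" for x using sub G_f[OF that] by blast
    next
      fix u v u' v' assume uv: "(u, v) \<in> G'" and uv': "(u', v') \<in> G'"
      obtain c e r where 1: "(c, e) \<in> G" "r \<in> carrier R" "u = c \<oplus>\<^bsub>B\<^esub> r \<odot>\<^bsub>B\<^esub> b" "v = e \<oplus>\<^bsub>E\<^esub> r \<odot>\<^bsub>E\<^esub> y"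
        using G'E[OF uv] by blast
      obtain c' e' r' where 2: "(c', e') \<in> G" "r' \<in> carrier R" "u' = c' \<oplus>\<^bsub>B\<^esub> r' \<odot>\<^bsub>B\<^esub> b" "v' = e' \<oplus>\<^bsub>E\<^esub> r' \<odot>\<^bsub>E\<^esub> y"
        using G'E[OF uv'] by blast
      have "u \<oplus>\<^bsub>B\<^esub> u' = (c \<oplus>\<^bsub>B\<^esub> c') \<oplus>\<^bsub>B\<^esub> (r \<oplus>\<^bsub>R\<^esub> r') \<odot>\<^bsub>B\<^esub> b"
        using 1 2 G_carr[OF 1(1)] G_carr[OF 2(1)] b by (simp add: B.smult_l_distr B.a_ac)
      moreover have "v \<oplus>\<^bsub>E\<^esub> v' = (e \<oplus>\<^bsub>E\<^esub> e') \<oplus>\<^bsub>E\<^esub> (r \<oplus>\<^bsub>R\<^esub> r') \<odot>\<^bsub>E\<^esub> y"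
        using 1 2 G_carr[OF 1(1)] G_carr[OF 2(1)] y(1) by (simp add: E.smult_l_distr E.a_ac)
      ultimately show "(u \<oplus>\<^bsub>B\<^esub> u', v \<oplus>\<^bsub>E\<^esub> v') \<in> G'"
        using G'I[OF G_add[OF 1(1) 2(1)], of "r \<oplus>\<^bsub>R\<^esub> r'"] 1(2) 2(2) by simp
    next
      fix s u v assume s: "s \<in> carrier R" and uv: "(u, v) \<in> G'"
      obtain c e r where 1: "(c, e) \<in> G" "r \<in> carrier R" "u = c \<oplus>\<^bsub>B\<^esub> r \<odot>\<^bsub>B\<^esub> b" "v = e \<oplus>\<^bsub>E\<^esub> r \<odot>\<^bsub>E\<^esub> y"
        using G'E[OF uv] by blast
      have "s \<odot>\<^bsub>B\<^esub> u = s \<odot>\<^bsub>B\<^esub> c \<oplus>\<^bsub>B\<^esub> (s \<otimes>\<^bsub>R\<^esub> r) \<odot>\<^bsub>B\<^esub> b"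
        using 1 s G_carr[OF 1(1)] b by (simp add: B.smult_r_distr B.smult_assoc1)
      moreover have "s \<odot>\<^bsub>E\<^esub> v = s \<odot>\<^bsub>E\<^esub> e \<oplus>\<^bsub>E\<^esub> (s \<otimes>\<^bsub>R\<^esub> r) \<odot>\<^bsub>E\<^esub> y"
        using 1 s G_carr[OF 1(1)] y(1) by (simp add: E.smult_r_distr E.smult_assoc1)
      ultimately show "(s \<odot>\<^bsub>B\<^esub> u, s \<odot>\<^bsub>E\<^esub> v) \<in> G'"
        using G'I[OF G_smult[OF s 1(1)], of "s \<otimes>\<^bsub>R\<^esub> r"] 1(2) s by simp
    next
      fix v assume v: "(\<zero>\<^bsub>B\<^esub>, v) \<in> G'"
      obtain c e r where 1: "(c, e) \<in> G" "r \<in> carrier R" "\<zero>\<^bsub>B\<^esub> = c \<oplus>\<^bsub>B\<^esub> r \<odot>\<^bsub>B\<^esub> b" "v = e \<oplus>\<^bsub>E\<^esub> r \<odot>\<^bsub>E\<^esub> y"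
        using G'E[OF v] by blast
      have "\<ominus>\<^bsub>B\<^esub> c = r \<odot>\<^bsub>B\<^esub> b"
        using 1(2,3) G_carr(1)[OF 1(1)] b B.minus_equality[of "r \<odot>\<^bsub>B\<^esub> b" c] by (simp add: B.a_comm)
      then have neg: "(r \<odot>\<^bsub>B\<^esub> b, \<ominus>\<^bsub>E\<^esub> e) \<in> G" using G_uminus[OF 1(1)] by simp
      then have "r \<in> J" unfolding J_def using 1(2) by blast
      then have "r \<odot>\<^bsub>E\<^esub> y = \<ominus>\<^bsub>E\<^esub> e" using y(2) \<phi>_eq[OF neg] by simp
      then show "v = \<zero>\<^bsub>E\<^esub>" using 1(4) G_carr(2)[OF 1(1)] by (simp add: E.r_neg)
    qed
    then have "G' = G" using maxG sub by blast
    then have "(\<zero>\<^bsub>B\<^esub> \<oplus>\<^bsub>B\<^esub> \<one>\<^bsub>R\<^esub> \<odot>\<^bsub>B\<^esub> b, \<zero>\<^bsub>E\<^esub> \<oplus>\<^bsub>E\<^esub> \<one>\<^bsub>R\<^esub> \<odot>\<^bsub>E\<^esub> y) \<in> G"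
      using G'I[OF G_00, of "\<one>\<^bsub>R\<^esub>"] by simp
    then show ?thesis using b by auto
  qed
  define g where "g b = (THE e. (b, e) \<in> G)" for b
  have g_eq: "g b = e" if "(b, e) \<in> G" for b e
    unfolding g_def using that G_unique by blast
  have g: "(b, g b) \<in> G" if "b \<in> carrier B" for b
    using total[OF that] g_eq by blast
  have "g \<in> mod_hom R B E"
    unfolding mod_hom_def
    using G_carr(2)[OF g] g_eq[OF G_add[OF g g]] g_eq[OF G_smult[OF _ g]] by blast
  moreover have "g (i x) = f x" if "x \<in> carrier A" for x
    by (rule g_eq[OF G_f[OF that]])
  ultimately show "\<exists>g\<in>mod_hom R B E. \<forall>x\<in>carrier A. g (i x) = f x" by blast
qed fact

corollary injective_module_any_type:
  fixes R :: "('a, 'r) ring_scheme"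
  assumes "injective_module TYPE('a) R E"
  shows "injective_module TYPE('t) R E"
  by (rule baer_criterion)
    (use assms injective_module_extend_ideal[OF assms] in \<open>auto simp: injective_module_def\<close>)

section \<open>Essential extensions of cyclic modules\<close>

text \<open>
  The module is the direct sum of the submodule on which \<open>g\<close> acts as the identity and the one that
  \<open>g\<close> annihilates. The first is non-zero because it contains \<open>g z\<close>, so the second is zero.
\<close>

lemma (in module) indecomposable_idempotent_acts_trivially:
  assumes ind: "indecomposable R M" and g: "g \<in> carrier R" "g \<otimes> g = g"
    and z: "z \<in> carrier M" "g \<odot>\<^bsub>M\<^esub> z \<noteq> \<zero>\<^bsub>M\<^esub>" and x: "x \<in> carrier M"
  shows "g \<odot>\<^bsub>M\<^esub> x = x"
proof -
  let ?U = "{x \<in> carrier M. g \<odot>\<^bsub>M\<^esub> x = x}" and ?V = "{x \<in> carrier M. g \<odot>\<^bsub>M\<^esub> x = \<zero>\<^bsub>M\<^esub>}"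
  have gg: "g \<odot>\<^bsub>M\<^esub> (g \<odot>\<^bsub>M\<^esub> y) = g \<odot>\<^bsub>M\<^esub> y" if "y \<in> carrier M" for y
    using smult_assoc1[OF g(1) g(1) that] g(2) by simp
  have comm: "g \<odot>\<^bsub>M\<^esub> (r \<odot>\<^bsub>M\<^esub> y) = r \<odot>\<^bsub>M\<^esub> (g \<odot>\<^bsub>M\<^esub> y)" if "r \<in> carrier R" "y \<in> carrier M" for r y
    using smult_assoc1[OF g(1) that] smult_assoc1[OF that(1) g(1) that(2)] m_comm[OF g(1) that(1)] by simp
  have U: "submodule ?U R M"
    by (rule submoduleI_smult) (use g(1) comm in \<open>auto simp: smult_r_distr\<close>)
  have V: "submodule ?V R M"
    by (rule submoduleI_smult) (use g(1) comm in \<open>auto simp: smult_r_distr\<close>)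
  have gU: "g \<odot>\<^bsub>M\<^esub> y \<in> ?U" and gV: "y \<ominus>\<^bsub>M\<^esub> g \<odot>\<^bsub>M\<^esub> y \<in> ?V" if "y \<in> carrier M" for y
    using that g(1) gg[OF that] by (simp_all add: M.minus_eq smult_r_distr smult_r_minus M.r_neg)
  have "set_add M ?U ?V = carrier M"
  proof
    show "set_add M ?U ?V \<subseteq> carrier M" by (auto simp: set_add_def')
    show "carrier M \<subseteq> set_add M ?U ?V"
    proof
      fix y assume y: "y \<in> carrier M"
      have "y = g \<odot>\<^bsub>M\<^esub> y \<oplus>\<^bsub>M\<^esub> (y \<ominus>\<^bsub>M\<^esub> g \<odot>\<^bsub>M\<^esub> y)"
        using y g(1) M.r_neg2[of "g \<odot>\<^bsub>M\<^esub> y" y] by (simp add: M.minus_eq M.a_ac)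
      then show "y \<in> set_add M ?U ?V"
        unfolding set_add_def' using gU[OF y] gV[OF y] by blast
    qed
  qed
  moreover have "?U \<inter> ?V = {\<zero>\<^bsub>M\<^esub>}" using g(1) by auto
  ultimately have "is_direct_sum R M ?U ?V" unfolding is_direct_sum_def using U V by blast
  then have "?U = {\<zero>\<^bsub>M\<^esub>} \<or> ?V = {\<zero>\<^bsub>M\<^esub>}" using ind unfolding indecomposable_def by blast
  then have "x \<ominus>\<^bsub>M\<^esub> g \<odot>\<^bsub>M\<^esub> x = \<zero>\<^bsub>M\<^esub>"
    using gU[OF z(1)] z(2) gV[OF x] by blast
  then have "x = \<ominus>\<^bsub>M\<^esub> (\<ominus>\<^bsub>M\<^esub> (g \<odot>\<^bsub>M\<^esub> x))"
    using x g(1) M.minus_equality[of x "\<ominus>\<^bsub>M\<^esub> (g \<odot>\<^bsub>M\<^esub> x)"] by (simp add: M.minus_eq)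
  then show ?thesis using x g(1) by simp
qed

text \<open>
  \<open>E\<close> is an essential extension of \<open>R/I\<close>, and \<open>j\<close> is the composite \<open>R \<rightarrow> R/I \<rightarrow> E\<close>. Stating the
  embedding in terms of \<open>j\<close> keeps cosets out of the arguments below.
\<close>

locale essential_cyclic_extension = regular_cring R + I: ideal I R + E: module R E
  for R (structure) and I and E +
  fixes j :: "'a \<Rightarrow> 'c"
  assumes j_closed [simp]: "r \<in> carrier R \<Longrightarrow> j r \<in> carrier E"
    and j_mult: "r \<in> carrier R \<Longrightarrow> s \<in> carrier R \<Longrightarrow> j (r \<otimes> s) = r \<odot>\<^bsub>E\<^esub> j s"
    and j_eq_zero_iff: "r \<in> carrier R \<Longrightarrow> j r = \<zero>\<^bsub>E\<^esub> \<longleftrightarrow> r \<in> I"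
    and essential: "submodule N R E \<Longrightarrow> N \<noteq> {\<zero>\<^bsub>E\<^esub>} \<Longrightarrow> \<exists>r\<in>carrier R. j r \<in> N \<and> r \<notin> I"
begin

text \<open>
  An indecomposable summand \<open>A\<close> contains \<open>j e\<close> for an idempotent \<open>e \<notin> I\<close>. As \<open>I + Re\<close> is not
  minimal over \<open>I\<close>, there is an ideal \<open>J\<close> strictly in between, and it contains an idempotent
  \<open>f \<notin> I\<close>. The idempotent \<open>g = e f\<close> agrees with \<open>f\<close> modulo \<open>I\<close>, so it is not in \<open>I\<close> either, and it
  must act on \<open>A\<close> as the identity. Then \<open>g j(e) = j(e)\<close> forces \<open>e - g e \<in> I\<close>, hence \<open>e \<in> J\<close> and
  \<open>J = I + Re\<close>, a contradiction.
\<close>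

lemma superdecomposable:
  assumes soc: "loewy_step R (self_module R) I = I" and proper: "I \<noteq> carrier R"
  shows "superdecomposable R E"
  unfolding superdecomposable_def
proof (intro conjI notI)
  assume "carrier E = {\<zero>\<^bsub>E\<^esub>}"
  then have "\<one> \<in> I" using j_closed[OF one_closed] j_eq_zero_iff[OF one_closed] by auto
  then show False using proper I.one_imp_carrier by blast
next
  assume "\<exists>A B. is_direct_sum R E A B \<and> indecomposable R (E\<lparr>carrier := A\<rparr>)"
  then obtain A where A: "submodule A R E" and ind: "indecomposable R (E\<lparr>carrier := A\<rparr>)"
    unfolding is_direct_sum_def by blast
  interpret A: module R "E\<lparr>carrier := A\<rparr>"
    by (rule submodule.submodule_is_module[OF A E.module_axioms])
  have "A \<noteq> {\<zero>\<^bsub>E\<^esub>}" using ind by (simp add: indecomposable_def)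
  then obtain r where r: "r \<in> carrier R" "j r \<in> A" "r \<notin> I" using essential[OF A] by blast
  obtain e x where e: "e \<in> carrier R" "x \<in> carrier R" "e \<otimes> e = e" "e = r \<otimes> x" "r = e \<otimes> r"
    using idempotent_generator[OF r(1)] .
  have eI: "e \<notin> I" using I.I_r_closed[of e r] r e(5) by auto
  have "j e = x \<odot>\<^bsub>E\<^esub> j r" using e(4) j_mult[OF e(2) r(1)] m_comm[OF e(2) r(1)] by simp
  then have jeA: "j e \<in> A" using submodule.smult_closed[OF A e(2) r(2)] by simp
  note ad = adjoin[OF I.is_ideal e(1)]
  have "\<not> minimal_over R I (adjoin I e)"
  proof
    assume "minimal_over R I (adjoin I e)"
    then have "e \<in> loewy_step R (self_module R) I"
      unfolding I.loewy_step_eq[OF is_cring] using ad(3) by blast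
    then show False using soc eI by simp
  qed
  then obtain J where J: "ideal J R" "I \<subseteq> J" "J \<subseteq> adjoin I e" "J \<noteq> I" "J \<noteq> adjoin I e"
    unfolding minimal_over_def using ad(1-3) eI by blast
  interpret J: ideal J R by (rule J(1))
  have eJ: "e \<notin> J" using ad(4)[OF J(1,2)] J(3,5) by blast
  obtain a where a: "a \<in> J" "a \<notin> I" using J(2,4) by blast
  obtain f y where f: "f \<in> carrier R" "y \<in> carrier R" "f \<otimes> f = f" "f = a \<otimes> y" "a = f \<otimes> a"
    using idempotent_generator[OF J.Icarr[OF a(1)]] .
  have fJ: "f \<in> J" unfolding f(4) by (rule J.I_r_closed[OF a(1) f(2)])
  have fI: "f \<notin> I" using I.I_r_closed[of f a] J.Icarr[OF a(1)] a(2) f(5) by auto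
  obtain u s where u: "u \<in> I" "s \<in> carrier R" "f = u \<oplus> s \<otimes> e"
    using subsetD[OF J(3) fJ] unfolding adjoin_def by blast
  have uR: "u \<in> carrier R" by (rule I.Icarr[OF u(1)])
  define g where "g = e \<otimes> f"
  have gR: "g \<in> carrier R" unfolding g_def using e(1) f(1) by simp
  have gJ: "g \<in> J" unfolding g_def by (rule J.I_l_closed[OF fJ e(1)])
  have gg: "g \<otimes> g = g"
  proof -
    have "g \<otimes> g = (e \<otimes> e) \<otimes> (f \<otimes> f)" unfolding g_def using e(1) f(1) by (simp add: m_ac)
    then show ?thesis using e(3) f(3) g_def by simp
  qed
  have ge: "g \<otimes> e = g"
  proof -
    have "g \<otimes> e = (e \<otimes> e) \<otimes> f" unfolding g_def using e(1) f(1) by (simp add: m_ac)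
    then show ?thesis using e(3) g_def by simp
  qed
  have gI: "g \<notin> I"
  proof
    assume "g \<in> I"
    have "g = e \<otimes> (u \<oplus> s \<otimes> e)" unfolding g_def u(3)[symmetric] ..
    also have "\<dots> = e \<otimes> u \<oplus> s \<otimes> (e \<otimes> e)"
      using e(1) u(2) uR by (simp add: r_distr m_ac)
    also have "\<dots> = e \<otimes> u \<oplus> s \<otimes> e" using e(3) by simp
    finally have "g = s \<otimes> e \<oplus> e \<otimes> u" using e(1) u(2) uR by (simp add: a_comm)
    then have "g \<ominus> e \<otimes> u = s \<otimes> e"
      using e(1) u(2) uR by (simp add: minus_eq a_assoc r_neg)
    moreover have "g \<ominus> e \<otimes> u \<in> I"
      using \<open>g \<in> I\<close> I.I_l_closed[OF u(1) e(1)] unfolding minus_eq by (intro I.a_closed) auto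
    ultimately have "f \<in> I" unfolding u(3) using u(1) I.a_closed by auto
    then show False using fI by blast
  qed
  have "g \<odot>\<^bsub>E\<^esub> j e \<noteq> \<zero>\<^bsub>E\<^esub>"
    using j_mult[OF gR e(1)] ge j_eq_zero_iff[OF gR] gI by simp
  then have "g \<odot>\<^bsub>E\<^esub> j e = j e"
    using A.indecomposable_idempotent_acts_trivially[OF ind gR gg, of "j e" "j e"] jeA by simp
  then have "(\<one> \<ominus> g) \<odot>\<^bsub>E\<^esub> j e = \<zero>\<^bsub>E\<^esub>"
    using gR e(1) by (simp add: minus_eq E.smult_l_distr E.smult_l_minus E.r_neg)
  then have "(\<one> \<ominus> g) \<otimes> e \<in> I"
    using j_mult[of "\<one> \<ominus> g" e] j_eq_zero_iff[of "(\<one> \<ominus> g) \<otimes> e"] gR e(1) by simp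
  then have "(\<one> \<ominus> g) \<otimes> e \<oplus> g \<in> J" using J(2) gJ by (intro J.a_closed) auto
  moreover have "(\<one> \<ominus> g) \<otimes> e \<oplus> g = e"
    using gR e(1) ge by (simp add: minus_eq l_distr l_minus a_assoc l_neg)
  ultimately show False using eJ by simp
qed

text \<open>
  If \<open>I \<subseteq> P\<close> and \<open>p j(1) = j(1)\<close> with \<open>p \<in> P\<close>, then \<open>1 - p \<in> I \<subseteq> P\<close>, which is absurd. If \<open>I\<close> is not
  contained in \<open>P\<close>, there is an idempotent \<open>e \<in> I - P\<close>. The submodule on which \<open>e\<close> acts as the
  identity meets the image of \<open>R/I\<close> trivially, so it is zero by essentiality. Thus \<open>e E = 0\<close>, and
  \<open>1 - e \<in> P\<close> acts as the identity.
\<close>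

lemma fixed_by_prime_iff:
  assumes P: "P \<in> Spec R"
  shows "(\<forall>y\<in>carrier E. \<exists>p\<in>P. p \<odot>\<^bsub>E\<^esub> y = y) \<longleftrightarrow> \<not> I \<subseteq> P"
proof
  interpret P: primeideal P R using P by (simp add: Spec_def)
  assume fixed: "\<forall>y\<in>carrier E. \<exists>p\<in>P. p \<odot>\<^bsub>E\<^esub> y = y"
  show "\<not> I \<subseteq> P"
  proof
    assume IP: "I \<subseteq> P"
    obtain p where p: "p \<in> P" "p \<odot>\<^bsub>E\<^esub> j \<one> = j \<one>" using fixed j_closed[OF one_closed] by blast
    have pR: "p \<in> carrier R" by (rule P.Icarr[OF p(1)])
    have "(\<one> \<ominus> p) \<odot>\<^bsub>E\<^esub> j \<one> = \<zero>\<^bsub>E\<^esub>"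
      using pR p(2) by (simp add: minus_eq E.smult_l_distr E.smult_l_minus E.r_neg)
    then have "\<one> \<ominus> p \<in> I"
      using j_mult[of "\<one> \<ominus> p" \<one>] j_eq_zero_iff[of "\<one> \<ominus> p"] pR by simp
    then have "(\<one> \<ominus> p) \<oplus> p \<in> P" using IP p(1) by (intro P.a_closed) auto
    then have "\<one> \<in> P" using pR by (simp add: minus_eq a_assoc l_neg)
    then show False using P.one_imp_carrier P.I_notcarr by blast
  qed
next
  interpret P: primeideal P R using P by (simp add: Spec_def)
  assume "\<not> I \<subseteq> P"
  then obtain a where a: "a \<in> I" "a \<notin> P" by blast
  have aR: "a \<in> carrier R" by (rule I.Icarr[OF a(1)])
  obtain e x where e: "e \<in> carrier R" "x \<in> carrier R" "e \<otimes> e = e" "e = a \<otimes> x" "a = e \<otimes> a"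
    using idempotent_generator[OF aR] .
  have eI: "e \<in> I" unfolding e(4) by (rule I.I_r_closed[OF a(1) e(2)])
  have eP: "e \<notin> P" using P.I_r_closed[of e a] aR a(2) e(5) by auto
  have "e \<otimes> (\<one> \<ominus> e) = \<zero>"
    using e(1,3) by (simp add: minus_eq r_distr r_minus r_neg)
  then have "e \<otimes> (\<one> \<ominus> e) \<in> P"
    using additive_subgroup.zero_closed[OF P.is_additive_subgroup] by simp
  then have oneP: "\<one> \<ominus> e \<in> P" using P.I_prime[of e "\<one> \<ominus> e"] eP e(1) by auto
  let ?N = "{y \<in> carrier E. e \<odot>\<^bsub>E\<^esub> y = y}"
  have N: "submodule ?N R E"
  proof (rule E.submoduleI_smult)
    fix r y assume r: "r \<in> carrier R" and y: "y \<in> ?N"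
    then have "e \<odot>\<^bsub>E\<^esub> (r \<odot>\<^bsub>E\<^esub> y) = r \<odot>\<^bsub>E\<^esub> (e \<odot>\<^bsub>E\<^esub> y)"
      using E.smult_assoc1[OF e(1) r, of y] E.smult_assoc1[OF r e(1), of y] m_comm[OF e(1) r] by simp
    then show "r \<odot>\<^bsub>E\<^esub> y \<in> ?N" using r y by simp
  qed (use e(1) in \<open>auto simp: E.smult_r_distr\<close>)
  have N0: "?N = {\<zero>\<^bsub>E\<^esub>}"
  proof (rule ccontr)
    assume "?N \<noteq> {\<zero>\<^bsub>E\<^esub>}"
    then obtain r where r: "r \<in> carrier R" "j r \<in> ?N" "r \<notin> I" using essential[OF N] by blast
    have "j (e \<otimes> r) = j r" using j_mult[OF e(1) r(1)] r(2) by simp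
    moreover have "j (e \<otimes> r) = \<zero>\<^bsub>E\<^esub>"
      using j_eq_zero_iff[of "e \<otimes> r"] I.I_r_closed[OF eI r(1)] e(1) r(1) by simp
    ultimately show False using j_eq_zero_iff[OF r(1)] r(3) by simp
  qed
  have eE: "e \<odot>\<^bsub>E\<^esub> y = \<zero>\<^bsub>E\<^esub>" if "y \<in> carrier E" for y
  proof -
    have "e \<odot>\<^bsub>E\<^esub> y \<in> ?N" using E.smult_assoc1[OF e(1) e(1) that] e(1,3) that by simp
    then show ?thesis unfolding N0 by simp
  qed
  have "(\<one> \<ominus> e) \<odot>\<^bsub>E\<^esub> y = y" if "y \<in> carrier E" for y
    using eE[OF that] that e(1) by (simp add: minus_eq E.smult_l_distr E.smult_l_minus)
  then show "\<forall>y\<in>carrier E. \<exists>p\<in>P. p \<odot>\<^bsub>E\<^esub> y = y" using oneP by blast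
qed

end

lemma injective_hull_embedding:
  assumes "regular_cring R" and I: "ideal I R"
    and hull: "injective_hull R (quot_module (self_module R) I) E"
  shows "\<exists>j. essential_cyclic_extension R I E j"
proof -
  interpret regular_cring R by fact
  interpret I: ideal I R by fact
  interpret E: module R E using hull by (simp add: injective_hull_def injective_module_def)
  let ?Q = "quot_module (self_module R) I"
  obtain i where i: "i \<in> mod_hom R ?Q E" "inj_on i (carrier ?Q)"
    and ess: "\<And>N. submodule N R E \<Longrightarrow> N \<noteq> {\<zero>\<^bsub>E\<^esub>} \<Longrightarrow> N \<inter> i ` carrier ?Q \<noteq> {\<zero>\<^bsub>E\<^esub>}"
    using hull unfolding injective_hull_def by blast
  interpret Q: module R ?Q by (rule I.quot_module[OF is_cring])
  have coset: "I +>\<^bsub>R\<^esub> r \<in> carrier ?Q" if "r \<in> carrier R" for r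
    using that by (simp add: I.quot_module_simps)
  have i_closed: "i X \<in> carrier E" if "X \<in> carrier ?Q" for X
    using i(1) that by (auto simp: mod_hom_def)
  have i_smult: "i (r \<odot>\<^bsub>?Q\<^esub> X) = r \<odot>\<^bsub>E\<^esub> i X" if "r \<in> carrier R" "X \<in> carrier ?Q" for r X
    using i(1) that by (simp add: mod_hom_def)
  have i_zero: "i \<zero>\<^bsub>?Q\<^esub> = \<zero>\<^bsub>E\<^esub>"
    using i_smult[OF zero_closed Q.zero_closed] i_closed[OF Q.zero_closed] by simp
  have zero_iff: "i (I +>\<^bsub>R\<^esub> r) = \<zero>\<^bsub>E\<^esub> \<longleftrightarrow> r \<in> I" if r: "r \<in> carrier R" for r
  proof -
    have "i (I +>\<^bsub>R\<^esub> r) = \<zero>\<^bsub>E\<^esub> \<longleftrightarrow> I +>\<^bsub>R\<^esub> r = \<zero>\<^bsub>?Q\<^esub>"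
      using inj_onD[OF i(2) _ coset[OF r] Q.zero_closed] i_zero by metis
    then show ?thesis using I.coset_eq_zero_iff[OF r] by (simp add: I.quot_module_simps)
  qed
  have "essential_cyclic_extension R I E (\<lambda>r. i (I +>\<^bsub>R\<^esub> r))"
  proof
    fix N assume N: "submodule N R E" "N \<noteq> {\<zero>\<^bsub>E\<^esub>}"
    have "\<zero>\<^bsub>E\<^esub> \<in> N \<inter> i ` carrier ?Q"
      using submodule_zero_mem[OF N(1)] i_zero Q.zero_closed by (metis IntI image_eqI)
    then obtain z where z: "z \<in> N" "z \<in> i ` carrier ?Q" "z \<noteq> \<zero>\<^bsub>E\<^esub>" using ess[OF N] by blast
    then obtain r where "r \<in> carrier R" "z = i (I +>\<^bsub>R\<^esub> r)" by (auto simp: I.quot_module_simps)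
    then show "\<exists>r\<in>carrier R. i (I +>\<^bsub>R\<^esub> r) \<in> N \<and> r \<notin> I" using z zero_iff by blast
  next
    fix r s assume "r \<in> carrier R" "s \<in> carrier R"
    then show "i (I +>\<^bsub>R\<^esub> (r \<otimes>\<^bsub>R\<^esub> s)) = r \<odot>\<^bsub>E\<^esub> i (I +>\<^bsub>R\<^esub> s)"
      using i_smult[of r "I +>\<^bsub>R\<^esub> s"] coset by (simp add: I.quot_smult)
  qed (use i_closed coset zero_iff in auto)
  then show ?thesis by blast
qed

section \<open>Support of a module\<close>

text \<open>
  The tensored stalk complex is \<open>Q \<otimes> E\<close> in degree \<open>0\<close> and \<open>Q \<otimes> 0\<close>, a trivial module, in all
  other degrees.
\<close>

lemma acyclic_tensor_stalk_iff:
  fixes E :: "('a, 'e) module"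
  assumes Q: "module R Q" and E: "module R E"
  shows "acyclic_complex (tensor_cpx R Q (stalk_complex E)) \<longleftrightarrow>
    carrier (tensor R Q E) = {tensor_rels R Q E}"
proof -
  interpret E: module R E by fact
  interpret QE: module_pair R Q E using Q E by (simp add: module_pair_def)
  let ?E0 = "E\<lparr>carrier := {\<zero>\<^bsub>E\<^esub>}\<rparr>" and ?z = "\<lambda>_. \<zero>\<^bsub>E\<^esub>"
  have "submodule {\<zero>\<^bsub>E\<^esub>} R E" by (rule E.submoduleI_smult) auto
  then have E0: "module R ?E0" by (rule submodule.submodule_is_module) fact
  interpret E0: module R ?E0 by (rule E0)
  interpret QE0: module_pair R Q ?E0 using Q E0 by (simp add: module_pair_def)
  define M where "M n = (if n = 0 then E else ?E0)" for n :: int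
  have M: "module R (M n)" for n using E E0 by (simp add: M_def)
  have z: "?z \<in> mod_hom R (M m) (M n)" for m n by (simp add: M_def mod_hom_def)
  let ?X = "tensor_cpx R Q (stalk_complex E)"
  have obj: "obj ?X n = tensor R Q (M n)" and dif: "dif ?X n = tensor_map R Q (M (n + 1)) ?z" for n
    by (simp_all add: tensor_cpx_def stalk_complex_def M_def)
  have zero: "\<zero>\<^bsub>tensor R Q (M n)\<^esub> = tensor_rels R Q (M n)" for n by (simp add: tensor_def)
  have dif_zero: "dif ?X n (tensor_rels R Q (M n)) = tensor_rels R Q (M (n + 1))" for n
    unfolding dif by (rule tensor_map_carrier(2)[OF Q M M z])
  have triv: "carrier (tensor R Q (M n)) = {tensor_rels R Q (M n)}" if "n \<noteq> 0" for n
  proof -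
    have "frag_of (x, \<zero>\<^bsub>R\<^esub> \<odot>\<^bsub>?E0\<^esub> \<zero>\<^bsub>E\<^esub>) \<in> QE0.rels" if "x \<in> carrier Q" for x
      using that by (intro QE0.annihilated_pure_tensor) auto
    then have "carrier (tensor R Q ?E0) = {QE0.rels}"
      unfolding QE0.carrier_tensor_trivial_iff by simp
    then show ?thesis using that by (simp add: M_def)
  qed
  show ?thesis
  proof
    assume "acyclic_complex ?X"
    then have "{x \<in> carrier (obj ?X 0). dif ?X 0 x = \<zero>\<^bsub>obj ?X (0 + 1)\<^esub>} =
        dif ?X (0 - 1) ` carrier (obj ?X (0 - 1))"
      unfolding acyclic_complex_def by blast
    then have ex: "{x \<in> carrier (tensor R Q (M 0)). dif ?X 0 x = tensor_rels R Q (M 1)} =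
        {tensor_rels R Q (M 0)}"
      using triv[of "-1"] dif_zero[of "-1"] by (simp add: obj zero)
    have "dif ?X 0 x = tensor_rels R Q (M 1)" if "x \<in> carrier (tensor R Q (M 0))" for x
      using tensor_map_carrier(1)[OF Q M[of 0] M[of 1] z] that triv[of 1] unfolding dif by auto
    then have "carrier (tensor R Q (M 0)) = {tensor_rels R Q (M 0)}" using ex by blast
    then show "carrier (tensor R Q E) = {QE.rels}" by (simp add: M_def)
  next
    assume "carrier (tensor R Q E) = {QE.rels}"
    then have "carrier (tensor R Q (M 0)) = {tensor_rels R Q (M 0)}" by (simp add: M_def)
    then have all: "carrier (tensor R Q (M n)) = {tensor_rels R Q (M n)}" for n
      using triv[of n] by (cases "n = 0") auto
    show "acyclic_complex ?X"
      unfolding acyclic_complex_def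
    proof
      fix n
      show "{x \<in> carrier (obj ?X n). dif ?X n x = \<zero>\<^bsub>obj ?X (n + 1)\<^esub>} =
          dif ?X (n - 1) ` carrier (obj ?X (n - 1))"
        using dif_zero[of n] dif_zero[of "n - 1"] by (auto simp: obj zero all)
    qed
  qed
qed

text \<open>
  Both sides say that \<open>E = PE\<close>. The elements of \<open>PE\<close> are those fixed by some \<open>p \<in> P\<close>: if \<open>y = p y'\<close>,
  then \<open>y\<close> is fixed by the idempotent that generates \<open>Rp\<close>.
\<close>

lemma (in regular_cring) quot_tensor_trivial_iff:
  assumes P: "P \<in> Spec R" and E: "module R E"
  shows "carrier (tensor R (quot_module (self_module R) P) E) =
      {tensor_rels R (quot_module (self_module R) P) E} \<longleftrightarrow>
    (\<forall>y\<in>carrier E. \<exists>p\<in>P. p \<odot>\<^bsub>E\<^esub> y = y)"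
proof -
  interpret P: primeideal P R using P by (simp add: Spec_def)
  interpret E: module R E by fact
  let ?Q = "quot_module (self_module R) P"
  have Q: "module R ?Q" by (rule P.quot_module[OF is_cring])
  interpret QE: module_pair R ?Q E using Q E by (simp add: module_pair_def)
  let ?H = "{y \<in> carrier E. \<exists>p\<in>P. p \<odot>\<^bsub>E\<^esub> y = y}"
  have zeroP: "\<zero> \<in> P" by (rule additive_subgroup.zero_closed[OF P.is_additive_subgroup])
  have H: "submodule ?H R E"
  proof (rule E.submoduleI_smult)
    show "?H \<subseteq> carrier E" by auto
    show "\<zero>\<^bsub>E\<^esub> \<in> ?H" by (intro CollectI conjI bexI[OF _ zeroP]) simp_all
  next
    fix y z assume "y \<in> ?H" "z \<in> ?H"
    then obtain p q where y: "y \<in> carrier E" "p \<in> P" "p \<odot>\<^bsub>E\<^esub> y = y"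
      and z: "z \<in> carrier E" "q \<in> P" "q \<odot>\<^bsub>E\<^esub> z = z" by blast
    have pq: "p \<in> carrier R" "q \<in> carrier R" using P.Icarr y z by auto
    \<comment> \<open>\<open>1 - t = (1 - p) (1 - q)\<close> annihilates both \<open>y\<close> and \<open>z\<close>\<close>
    define t where "t = p \<oplus> q \<ominus> p \<otimes> q"
    have tP: "t \<in> P"
      unfolding t_def minus_eq using y(2) z(2) P.I_r_closed[OF y(2) pq(2)]
      by (intro P.a_closed P.a_inv_closed)
    have ty: "t \<odot>\<^bsub>E\<^esub> y = y"
    proof -
      have "t \<odot>\<^bsub>E\<^esub> y = (p \<oplus> q \<ominus> q \<otimes> p) \<odot>\<^bsub>E\<^esub> y" unfolding t_def using m_comm[OF pq] by simp
      also have "\<dots> = p \<odot>\<^bsub>E\<^esub> y \<oplus>\<^bsub>E\<^esub> q \<odot>\<^bsub>E\<^esub> y \<oplus>\<^bsub>E\<^esub> \<ominus>\<^bsub>E\<^esub> (q \<odot>\<^bsub>E\<^esub> (p \<odot>\<^bsub>E\<^esub> y))"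
        using pq y(1) by (simp add: minus_eq E.smult_l_distr E.smult_l_minus E.smult_assoc1)
      also have "\<dots> = y" using pq y(1,3) by (simp add: E.a_assoc E.r_neg)
      finally show ?thesis .
    qed
    have tz: "t \<odot>\<^bsub>E\<^esub> z = z"
    proof -
      have "t \<odot>\<^bsub>E\<^esub> z = p \<odot>\<^bsub>E\<^esub> z \<oplus>\<^bsub>E\<^esub> q \<odot>\<^bsub>E\<^esub> z \<oplus>\<^bsub>E\<^esub> \<ominus>\<^bsub>E\<^esub> (p \<odot>\<^bsub>E\<^esub> (q \<odot>\<^bsub>E\<^esub> z))"
        unfolding t_def using pq z(1)
        by (simp add: minus_eq E.smult_l_distr E.smult_l_minus E.smult_assoc1)
      also have "\<dots> = z \<oplus>\<^bsub>E\<^esub> p \<odot>\<^bsub>E\<^esub> z \<oplus>\<^bsub>E\<^esub> \<ominus>\<^bsub>E\<^esub> (p \<odot>\<^bsub>E\<^esub> z)"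
        using pq z(1,3) by (simp add: E.a_comm)
      also have "\<dots> = z" using pq z(1) by (simp add: E.a_assoc E.r_neg)
      finally show ?thesis .
    qed
    have "t \<odot>\<^bsub>E\<^esub> (y \<oplus>\<^bsub>E\<^esub> z) = y \<oplus>\<^bsub>E\<^esub> z"
      using ty tz y(1) z(1) P.Icarr[OF tP] by (simp add: E.smult_r_distr)
    then show "y \<oplus>\<^bsub>E\<^esub> z \<in> ?H" using tP y(1) z(1) by auto
  next
    fix r y assume r: "r \<in> carrier R" and "y \<in> ?H"
    then obtain p where y: "y \<in> carrier E" "p \<in> P" "p \<odot>\<^bsub>E\<^esub> y = y" by blast
    have "p \<odot>\<^bsub>E\<^esub> (r \<odot>\<^bsub>E\<^esub> y) = r \<odot>\<^bsub>E\<^esub> (p \<odot>\<^bsub>E\<^esub> y)"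
      using E.smult_assoc1[of p r y] E.smult_assoc1[of r p y] m_comm[of p r] r y(1) P.Icarr[OF y(2)]
      by simp
    then show "r \<odot>\<^bsub>E\<^esub> y \<in> ?H" using r y by auto
  qed
  have PE: "p \<odot>\<^bsub>E\<^esub> y \<in> ?H" if p: "p \<in> P" and y: "y \<in> carrier E" for p y
  proof -
    have pR: "p \<in> carrier R" by (rule P.Icarr[OF p])
    obtain e x where e: "e \<in> carrier R" "x \<in> carrier R" "e \<otimes> e = e" "e = p \<otimes> x" "p = e \<otimes> p"
      using idempotent_generator[OF pR] .
    have "e \<in> P" unfolding e(4) by (rule P.I_r_closed[OF p e(2)])
    moreover have "e \<odot>\<^bsub>E\<^esub> (p \<odot>\<^bsub>E\<^esub> y) = p \<odot>\<^bsub>E\<^esub> y"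
      using E.smult_assoc1[OF e(1) pR y] e(5) by simp
    ultimately show ?thesis using pR y by auto
  qed
  show ?thesis
  proof
    assume "carrier (tensor R ?Q E) = {QE.rels}"
    then have "frag_of (P +> \<one>, y) \<in> QE.rels" if "y \<in> carrier E" for y
      unfolding QE.carrier_tensor_trivial_iff using that by (simp add: P.quot_module_simps)
    then have "y \<in> ?H" if "y \<in> carrier E" for y
      using P.quot_tensor_vanishing[OF is_cring E H PE that] that by blast
    then show "\<forall>y\<in>carrier E. \<exists>p\<in>P. p \<odot>\<^bsub>E\<^esub> y = y" by blast
  next
    assume fixed: "\<forall>y\<in>carrier E. \<exists>p\<in>P. p \<odot>\<^bsub>E\<^esub> y = y"
    have "frag_of (X, y) \<in> QE.rels" if X: "X \<in> carrier ?Q" and y: "y \<in> carrier E" for X y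
    proof -
      obtain p where p: "p \<in> P" "p \<odot>\<^bsub>E\<^esub> y = y" using fixed y by blast
      have pR: "p \<in> carrier R" by (rule P.Icarr[OF p(1)])
      obtain r where r: "r \<in> carrier R" "X = P +> r" using X by (auto simp: P.quot_module_simps)
      have "p \<odot>\<^bsub>?Q\<^esub> X = \<zero>\<^bsub>?Q\<^esub>"
        unfolding r(2) P.quot_smult[OF pR r(1)] P.quot_module_simps
        using P.coset_eq_zero_iff[of "p \<otimes> r"] P.I_r_closed[OF p(1) r(1)] pR r(1) by simp
      from QE.annihilated_pure_tensor[OF pR X y this] show ?thesis using p(2) by simp
    qed
    then show "carrier (tensor R ?Q E) = {QE.rels}"
      unfolding QE.carrier_tensor_trivial_iff by blast
  qed
qed

section \<open>The maximal perfect subset\<close>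

text \<open>
  A point of \<open>B \<subseteq> A\<close> that is isolated in \<open>A\<close> is isolated in \<open>B\<close>, so no derivative removes a
  point of \<open>B\<close>.
\<close>

lemma perfect_subset_cb_derivative:
  fixes \<alpha> :: "'o :: wellorder"
  assumes "perfect_subset X B"
  shows "B \<subseteq> cb_derivative X \<alpha>"
proof (induction \<alpha> rule: less_induct)
  case (less \<alpha>)
  show ?case
  proof (cases \<alpha> rule: wellorder_trichotomy)
    case zero
    then show ?thesis
      using assms by (simp add: cb_derivative_def transfinite_iter_zero perfect_subset_def)
  next
    case (osucc \<beta>)
    let ?A = "cb_derivative X \<beta>"
    have c: "cb_derivative X \<alpha> = ?A - isolated_points X ?A"
      unfolding cb_derivative_def osucc(2) by (rule transfinite_iter_osucc[OF osucc(1)])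
    have B: "B \<subseteq> ?A" by (rule less) (use osucc in simp)
    have "x \<notin> isolated_points X ?A" if x: "x \<in> B" for x
    proof
      assume "x \<in> isolated_points X ?A"
      then obtain U where U: "openin X U" "{x} = U \<inter> ?A"
        by (auto simp: isolated_points_def openin_subtopology)
      then have "{x} = U \<inter> B" using B x by blast
      then have "x \<in> isolated_points X B"
        unfolding isolated_points_def openin_subtopology using x U(1) by blast
      then show False using assms by (simp add: perfect_subset_def)
    qed
    then show ?thesis using B c by blast
  next
    case (limit \<gamma>)
    have "cb_derivative X \<alpha> = \<Inter>(cb_derivative X ` {..<\<alpha>})"
      unfolding cb_derivative_def by (rule transfinite_iter_limit[OF limit]; assumption)
    then show ?thesis using less by (simp add: le_INF_iff)
  qed
qed

theorem theorem4p11: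
  fixes R :: "('a, 'r) ring_scheme" and E :: "('a, 'e) module" and \<sigma> :: "('a + nat) ordinal"
  assumes "cring R" and "absolutely_flat R" and "\<not> semi_artinian R"
    and "\<sigma> = loewy_length R"
    and "injective_hull R
           (quot_module (self_module R) (ideal_Inter R (cb_derivative (zariski R) \<sigma>))) E"
  shows "injective_module TYPE('t) R E \<and> superdecomposable R E \<and>
    Supp R (stalk_complex E) = cb_derivative (zariski R) \<sigma> \<and>
    max_perfect_subset (zariski R) (cb_derivative (zariski R) \<sigma>)"
proof -
  interpret regular_cring R by (rule absolutely_flat_imp_regular) fact+
  define I where "I = loewy R (self_module R) \<sigma>"
  have I: "ideal I R" unfolding I_def by (rule ideal_loewy)
  have "\<exists>\<alpha> :: ('a + nat) ordinal. loewy R (self_module R) \<alpha> = loewy R (self_module R) (osucc \<alpha>)"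
    by (rule mono_ordinal_sequence_stabilizes) (rule loewy_mono)
  then have "loewy R (self_module R) \<sigma> = loewy R (self_module R) (osucc \<sigma>)"
    unfolding assms(4) loewy_length_def by (rule LeastI_ex)
  moreover have "loewy R (self_module R) (osucc \<sigma>) = loewy_step R (self_module R) I"
    unfolding I_def loewy_def by (rule transfinite_iter_osucc[OF osucc_greater])
  ultimately have step: "loewy_step R (self_module R) I = I" by (simp add: I_def)
  have cb: "cb_derivative (zariski R) \<sigma> = zero_locus R I"
    unfolding I_def by (rule cb_derivative_eq_zero_locus)
  have proper: "I \<noteq> carrier R" using assms(3) unfolding semi_artinian_def I_def by blast
  have hull: "injective_hull R (quot_module (self_module R) I) E"
    using assms(5) unfolding cb Inter_zero_locus[OF I] .
  obtain j where "essential_cyclic_extension R I E j"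
    using injective_hull_embedding[OF regular_cring_axioms I hull] by blast
  then interpret essential_cyclic_extension R I E j .
  have "injective_module TYPE('a) R E" using hull by (simp add: injective_hull_def)
  then have "injective_module TYPE('t) R E" by (rule injective_module_any_type)
  moreover have "superdecomposable R E" by (rule superdecomposable[OF step proper])
  moreover have "Supp R (stalk_complex E) = zero_locus R I"
  proof -
    have "acyclic_complex (tensor_cpx R (quot_module (self_module R) P) (stalk_complex E)) \<longleftrightarrow>
        \<not> I \<subseteq> P" if P: "P \<in> Spec R" for P
    proof -
      interpret P: primeideal P R using P by (simp add: Spec_def)
      show ?thesis
        unfolding acyclic_tensor_stalk_iff[OF P.quot_module[OF is_cring] E.module_axioms]
          quot_tensor_trivial_iff[OF P E.module_axioms]
        by (rule fixed_by_prime_iff[OF P])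
    qed
    then show ?thesis unfolding Supp_def zero_locus_def by blast
  qed
  moreover have "max_perfect_subset (zariski R) (zero_locus R I)"
    unfolding max_perfect_subset_def
  proof (intro conjI allI impI)
    have "isolated_points (zariski R) (zero_locus R I) = {}"
      unfolding isolated_points_zero_locus[OF I] step by (auto simp: zero_locus_def)
    then show "perfect_subset (zariski R) (zero_locus R I)"
      by (auto simp: perfect_subset_def topspace_zariski zero_locus_def)
    fix B assume "perfect_subset (zariski R) B"
    from perfect_subset_cb_derivative[OF this, of \<sigma>] show "B \<subseteq> zero_locus R I"
      unfolding cb .
  qed
  ultimately show ?thesis unfolding cb by blast
qed

end
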